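(* Let $G$ be a connected finite simple graph with $N\ge 3$ vertices and $E$ edges, let $\boldsymbol{\gamma}\in\mathbb{R}^E$ be a vector of real edge weights (of arbitrary signs), and let $L(\boldsymbol{\gamma})$ be the associated weighted graph Laplacian. Let $$Q=\frac1E\sum_{\text{edges } ij}\gamma_{ij},\qquad P=\frac1E\sum_{\text{edges } ij}\gamma_{ij}^2.$$ Let $\lambda_2^G$ and $\lambda_N^G$ be the second smallest and the largest eigenvalue of the equally weighted Laplacian $L(\boldsymbol{1}_E)$, and let $$\mu=\max_{\boldsymbol{\eta}\in\mathbb{R}^E\setminus\{0\},\ \boldsymbol{\eta}\perp\boldsymbol{1}_E}\frac{\langle\boldsymbol{\eta},(4I+A^{LG(G)})\boldsymbol{\eta}\rangle}{\Vert\boldsymbol{\eta}\Vert^2},$$ where $A^{LG(G)}$ is the adjacency matrix of the line graph of $G$. Then: (1) The $N-1$ eigenvalues $\lambda_i(L(\boldsymbol{\gamma}))$ of $L(\boldsymbol{\gamma})$ corresponding to eigenvectors orthogonal to $\boldsymbol{1}_N$ satisfy $$Q\lambda_2^G-\sqrt{E(P-Q^2)\,\mu\,\frac{N-2}{N-1}}\ \le\ \lambda_i(L(\boldsymbol{\gamma}))\ \le\ Q\lambda_N^G+\sqrt{E(P-Q^2)\,\mu\,\frac{N-2}{N-1}}.$$ (2) Further, this inequality is tight: for the complete graph there are choices of edge weights realizing the upper and lower bounds. (3) In particular, if $G$ is a $d$-regular graph, then these $N-1$ eigenvalues satisfy $$Q\lambda_2^G-\sqrt{E(P-Q^2)(2d+2-\lambda_2^G)\frac{N-2}{N-1}}\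 \le\ \lambda_i(L(\boldsymbol{\gamma}))\ \le\ Q\lambda_N^G+\sqrt{E(P-Q^2)(2d+2-\lambda_2^G)\frac{N-2}{N-1}}.$$
   Context: For a finite simple graph $G$ with vertices $1,\dots,N$ and $E$ edges, write $i\sim j$ if the distinct vertices $i,j$ are joined by an edge. A vector $\boldsymbol{\gamma}\in\mathbb{R}^E$ assigns to each edge $ij$ a real weight $\gamma_{ij}=\gamma_{ji}$ (no sign assumption). The weighted (signed) graph Laplacian $L(\boldsymbol{\gamma})$ is the symmetric $N\times N$ matrix with $L_{ii}=\sum_{k\sim i}\gamma_{ik}$, $L_{ij}=-\gamma_{ij}$ if $i\ne j$ and $i\sim j$, and $L_{ij}=0$ if $i\neq j$ and $i\not\sim j$. The vectors $\boldsymbol{1}_N\in\mathbb{R}^N$ and $\boldsymbol{1}_E\in\mathbb{R}^E$ have all entries equal to $1$. The vector $\boldsymbol{1}_N$ always lies in the kernel of $L(\boldsymbol{\gamma})$; "the $N-1$ eigenvalues corresponding to eigenvectors orthogonal to $\boldsymbol{1}_N$" are the eigenvalues, counted with multiplicity, of $L(\boldsymbol{\gamma})$ restricted to the invariant subspace $\boldsymbol{1}_N^\perp$. The equally weighted Laplacian $L(\boldsymbol{1}_E)$ is the case where all weights are $1$; for $G$ connected its eigenvalues are numbered $0=\lambda_1^G<\lambda_2^G\le\dots\le\lambda_N^G$. The line graph $LG(G)$ has as vertices the edges of $G$, two distinct ones being adjacent when the corresponding edges of $G$ share a vertex; its adjacency matrix $A^{LG(G)}$ is an $E\times E$ matrix.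 $\langle\cdot,\cdot\rangle$ and $\Vert\cdot\Vert$ are the Euclidean inner product and norm on $\mathbb{R}^E$. By the Cauchy–Schwarz inequality $P-Q^2\ge 0$.
   Formalization: The inequalities in (1) and (3) are false as printed when Q<0 (path on 3 vertices, all weights −1); they are proved as displayed for Q≥0, and with λ_2^G and λ_N^G exchanged for Q≤0. *)

theory Defs
  imports "Jordan_Normal_Form.Char_Poly" "HOL-Analysis.Function_Topology"
begin

text \<open>
  Vertices are numbered \<open>0, \<dots>, N - 1\<close> (matching the matrix indices) instead of
  \<open>1, \<dots>, N\<close>. An edge is a two-element set of vertices. A vector in \<open>\<real>\<^sup>E\<close> is a function
  on edges, of which only the values on the edge set matter; in particular
  \<open>\<gamma> {i, j} = \<gamma> {j, i}\<close> holds automatically, and \<open>\<lambda>_. 1\<close> is the all-ones vector.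
\<close>

definition simple_graph :: "nat \<Rightarrow> nat set set \<Rightarrow> bool" where
  "simple_graph N Es \<longleftrightarrow> (\<forall>e\<in>Es. e \<subseteq> {..<N} \<and> card e = 2)"

definition connected_graph :: "nat \<Rightarrow> nat set set \<Rightarrow> bool" where
  "connected_graph N Es \<longleftrightarrow> (\<forall>i<N. \<forall>j<N. (i, j) \<in> {(u, v). {u, v} \<in> Es}\<^sup>*)"

definition regular_graph :: "nat \<Rightarrow> nat set set \<Rightarrow> nat \<Rightarrow> bool" where
  "regular_graph N Es d \<longleftrightarrow> (\<forall>i<N. card {k. k < N \<and> {i, k} \<in> Es} = d)"

definition complete_edges :: "nat \<Rightarrow> nat set set" where
  "complete_edges N = {e. e \<subseteq> {..<N} \<and> card e = 2}"

definition laplacian :: "nat \<Rightarrow> nat set set \<Rightarrow> (nat set \<Rightarrow> real) \<Rightarrow> real mat" where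
  "laplacian N Es \<gamma> = mat N N (\<lambda>(i, j).
     if i = j then \<Sum>k | k < N \<and> {i, k} \<in> Es. \<gamma> {i, k}
     else if {i, j} \<in> Es then - \<gamma> {i, j}
     else 0)"

definition sorted_eigenvalues :: "real mat \<Rightarrow> real list" where
  "sorted_eigenvalues A = sorted_list_of_multiset (proots (char_poly A))"

text \<open>
  \<open>graph_eigenvalue N Es k\<close> is \<open>\<lambda>\<^sub>k\<close>, for \<open>1 \<le> k \<le> N\<close>: the \<open>k\<close>-th smallest eigenvalue, with
  multiplicity, of the equally weighted Laplacian.
\<close>

definition graph_eigenvalue :: "nat \<Rightarrow> nat set set \<Rightarrow> nat \<Rightarrow> real" where
  "graph_eigenvalue N Es k = sorted_eigenvalues (laplacian N Es (\<lambda>_. 1)) ! (k - 1)"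

text \<open>Eigenvalues of \<open>A\<close> having an eigenvector orthogonal to the all-ones vector.\<close>

definition orth_eigenvalue :: "real mat \<Rightarrow> real \<Rightarrow> bool" where
  "orth_eigenvalue A l \<longleftrightarrow>
     (\<exists>v. eigenvector A v l \<and> scalar_prod v (vec (dim_row A) (\<lambda>_. 1)) = 0)"

definition weight_mean :: "nat set set \<Rightarrow> (nat set \<Rightarrow> real) \<Rightarrow> real" where
  "weight_mean Es \<gamma> = (\<Sum>e\<in>Es. \<gamma> e) / real (card Es)"

definition weight_mean_sq :: "nat set set \<Rightarrow> (nat set \<Rightarrow> real) \<Rightarrow> real" where
  "weight_mean_sq Es \<gamma> = (\<Sum>e\<in>Es. (\<gamma> e)\<^sup>2) / real (card Es)"

definition line_graph :: "'a set set \<Rightarrow> 'a set set set" where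
  "line_graph Es = {{e, f} | e f. e \<in> Es \<and> f \<in> Es \<and> e \<noteq> f \<and> e \<inter> f \<noteq> {}}"

definition adjacency :: "'a set set \<Rightarrow> 'a \<Rightarrow> 'a \<Rightarrow> real" where
  "adjacency Es u v = (if {u, v} \<in> Es then 1 else 0)"

definition edge_inner :: "nat set set \<Rightarrow> (nat set \<Rightarrow> real) \<Rightarrow> (nat set \<Rightarrow> real) \<Rightarrow> real" where
  "edge_inner Es \<eta> \<zeta> = (\<Sum>e\<in>Es. \<eta> e * \<zeta> e)"

definition four_plus_line_adj ::
    "nat set set \<Rightarrow> (nat set \<Rightarrow> real) \<Rightarrow> nat set \<Rightarrow> real" where
  "four_plus_line_adj Es \<eta> e =
     (\<Sum>f\<in>Es. (4 * (if e = f then 1 else 0) + adjacency (line_graph Es) e f) * \<eta> f)"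

definition mu_quotients :: "nat set set \<Rightarrow> real set" where
  "mu_quotients Es =
     {edge_inner Es \<eta> (four_plus_line_adj Es \<eta>) / edge_inner Es \<eta> \<eta> | \<eta>.
        (\<exists>e\<in>Es. \<eta> e \<noteq> 0) \<and> edge_inner Es \<eta> (\<lambda>_. 1) = 0}"

text \<open>The supremum is attained as soon as there are two edges; see \<open>mu_is_maximum\<close> below.\<close>

definition mu :: "nat set set \<Rightarrow> real" where
  "mu Es = Sup (mu_quotients Es)"

definition deviation_bound ::
    "nat \<Rightarrow> nat set set \<Rightarrow> (nat set \<Rightarrow> real) \<Rightarrow> real \<Rightarrow> real" where
  "deviation_bound N Es \<gamma> m =
     sqrt (real (card Es) * (weight_mean_sq Es \<gamma> - (weight_mean Es \<gamma>)\<^sup>2) * m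
           * ((real N - 2) / (real N - 1)))"

lemma mu_is_maximum:
  assumes fin: "finite Es" and two: "2 \<le> card Es"
  shows "mu Es \<in> mu_quotients Es" and "\<forall>x\<in>mu_quotients Es. x \<le> mu Es"
proof -
  define F where "F = (\<lambda>\<eta>. edge_inner Es \<eta> (four_plus_line_adj Es \<eta>))"
  define K where "K = {\<eta>. (\<forall>e. e \<notin> Es \<longrightarrow> \<eta> e = 0) \<and> edge_inner Es \<eta> \<eta> = 1
                          \<and> edge_inner Es \<eta> (\<lambda>_. 1) = 0}"
  have cont: "continuous_on UNIV (\<lambda>\<eta>::nat set \<Rightarrow> real. \<eta> e)" for e
    by simp
  have contF: "continuous_on UNIV F"
    unfolding F_def edge_inner_def four_plus_line_adj_def
    by (intro continuous_intros cont)
  have clK: "closed K"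
    unfolding K_def edge_inner_def
    by (intro closed_Collect_conj closed_Collect_all closed_Collect_imp closed_Collect_eq
        open_Collect_const continuous_intros cont)
  have box: "K \<subseteq> (\<Pi>\<^sub>E e\<in>UNIV. {-1..1})"
  proof
    fix \<eta> assume k: "\<eta> \<in> K"
    have "\<bar>\<eta> e\<bar> \<le> 1" for e
    proof (cases "e \<in> Es")
      case True
      then have "\<eta> e * \<eta> e \<le> edge_inner Es \<eta> \<eta>"
        unfolding edge_inner_def using fin by (intro member_le_sum) auto
      with k show ?thesis by (simp add: K_def abs_le_square_iff[of _ 1, simplified] power2_eq_square)
    qed (use k in \<open>simp add: K_def\<close>)
    then show "\<eta> \<in> (\<Pi>\<^sub>E e\<in>UNIV. {-1..1})" by (auto simp: abs_le_iff minus_le_iff)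
  qed
  have "compactin (product_topology (\<lambda>_. euclidean) UNIV) (\<Pi>\<^sub>E e\<in>(UNIV :: nat set set). {-1..1::real})"
    by (subst compactin_PiE) auto
  then have "compact (\<Pi>\<^sub>E e\<in>(UNIV :: nat set set). {-1..1::real})"
    by (simp add: euclidean_product_topology)
  then have cK: "compact K"
    using clK box compact_Int_closed[of _ K] by (metis inf.absorb2)
  have scale: "\<exists>\<zeta>\<in>K. F \<zeta> = F \<eta> / edge_inner Es \<eta> \<eta>"
    if nz: "\<exists>e\<in>Es. \<eta> e \<noteq> 0" and orth: "edge_inner Es \<eta> (\<lambda>_. 1) = 0" for \<eta>
  proof -
    define s where "s = edge_inner Es \<eta> \<eta>"
    have s: "s > 0"
    proof -
      from nz obtain e where e: "e \<in> Es" "\<eta> e \<noteq> 0" by blast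
      then have "0 < \<eta> e * \<eta> e" by (metis not_real_square_gt_zero)
      also have "\<dots> \<le> s" unfolding s_def edge_inner_def
        using fin e by (intro member_le_sum) auto
      finally show ?thesis .
    qed
    define \<zeta> where "\<zeta> = (\<lambda>e. if e \<in> Es then \<eta> e / sqrt s else 0)"
    have "edge_inner Es \<zeta> \<zeta> = s / s"
    proof -
      have "edge_inner Es \<zeta> \<zeta> = (\<Sum>e\<in>Es. \<eta> e * \<eta> e / s)"
        using s unfolding edge_inner_def by (intro sum.cong) (auto simp: \<zeta>_def)
      then show ?thesis by (simp add: sum_divide_distrib[symmetric] s_def edge_inner_def)
    qed
    moreover have "edge_inner Es \<zeta> (\<lambda>_. 1) = edge_inner Es \<eta> (\<lambda>_. 1) / sqrt s"
      by (simp add: \<zeta>_def edge_inner_def sum_divide_distrib)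
    moreover have "F \<zeta> = F \<eta> / s"
    proof -
      have "four_plus_line_adj Es \<zeta> e = four_plus_line_adj Es \<eta> e / sqrt s" for e
        unfolding four_plus_line_adj_def sum_divide_distrib
        by (intro sum.cong) (auto simp: \<zeta>_def)
      then show ?thesis using s unfolding F_def edge_inner_def sum_divide_distrib
        by (intro sum.cong) (auto simp: \<zeta>_def)
    qed
    ultimately show ?thesis
      using s orth by (intro bexI[of _ \<zeta>]) (auto simp: K_def s_def[symmetric] \<zeta>_def)
  qed
  have quot: "mu_quotients Es = F ` K"
  proof
    show "mu_quotients Es \<subseteq> F ` K"
    proof
      fix x assume "x \<in> mu_quotients Es"
      then obtain \<eta> where x: "x = F \<eta> / edge_inner Es \<eta> \<eta>"
        and \<eta>: "\<exists>e\<in>Es. \<eta> e \<noteq> 0" "edge_inner Es \<eta> (\<lambda>_. 1) = 0"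
        unfolding mu_quotients_def F_def by blast
      from scale[OF \<eta>] x show "x \<in> F ` K" by (metis imageI)
    qed
    show "F ` K \<subseteq> mu_quotients Es"
    proof clarify
      fix \<eta> assume k: "\<eta> \<in> K"
      have "\<exists>e\<in>Es. \<eta> e \<noteq> 0"
      proof (rule ccontr)
        assume "\<not> ?thesis"
        then have "edge_inner Es \<eta> \<eta> = 0" by (simp add: edge_inner_def)
        with k show False by (simp add: K_def)
      qed
      with k show "F \<eta> \<in> mu_quotients Es"
        unfolding mu_quotients_def F_def K_def by (auto intro!: exI[of _ \<eta>])
    qed
  qed
  have ne: "F ` K \<noteq> {}"
  proof -
    obtain T where "T \<subseteq> Es" "card T = 2" using two by (meson obtain_subset_with_card_n)
    then obtain a b where ab: "a \<in> Es" "b \<in> Es" "a \<noteq> b" by (auto simp: card_2_iff)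
    define \<eta> where "\<eta> = (\<lambda>e. (if e = a then 1 else 0) - (if e = b then 1 else (0::real)))"
    have "edge_inner Es \<eta> (\<lambda>_. 1) = 0"
      using fin ab by (simp add: edge_inner_def \<eta>_def sum_subtractf)
    moreover have "\<exists>e\<in>Es. \<eta> e \<noteq> 0" using ab by (intro bexI[of _ a]) (auto simp: \<eta>_def)
    ultimately obtain \<zeta> where "\<zeta> \<in> K" using scale[of \<eta>] by auto
    then show ?thesis by blast
  qed
  have "compact (F ` K)"
    using cK contF compact_continuous_image continuous_on_subset by blast
  then obtain m where m: "m \<in> F ` K" "\<forall>x\<in>F ` K. x \<le> m"
    using compact_attains_sup[OF _ ne] by blast
  then have "mu Es = m"
    unfolding mu_def quot by (intro cSup_eq_maximum) auto
  with m show "mu Es \<in> mu_quotients Es" "\<forall>x\<in>mu_quotients Es. x \<le> mu Es"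
    by (auto simp: quot)
qed

end

theory Submission
  imports Defs "HOL-Analysis.L2_Norm"
begin

text \<open>
  Write \<open>\<gamma> = Q \<one> + \<eta>\<close> with \<open>\<eta> \<perp> \<one>\<close>. For a unit vector \<open>v \<perp> \<one>\<close>, the form \<open>v\<^sup>T L(\<one>) v\<close> lies
  between \<open>\<lambda>\<^sub>2\<close> and \<open>\<lambda>\<^sub>N\<close>, so only \<open>v\<^sup>T L(\<eta>) v\<close> has to be controlled. Since \<open>L(\<eta>)\<close> is trace-free
  and kills \<open>\<one>\<close>, its Frobenius product with \<open>v v\<^sup>T\<close> equals that with
  \<open>X = v v\<^sup>T - (I - J / N) / (N - 1)\<close>, and \<open>X\<close> has squared norm \<open>(N - 2) / (N - 1)\<close>. On the other hand
  the squared Frobenius norm of \<open>L(\<eta>)\<close> is \<open>2 |\<eta>|\<^sup>2 + |B \<eta>|\<^sup>2 = \<langle>\<eta>, (4 I + A) \<eta>\<rangle>\<close>, where \<open>B\<close> is the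
  unsigned incidence matrix and \<open>A\<close> the adjacency matrix of the line graph, so Cauchy-Schwarz
  gives (1). For (3), \<open>B B\<^sup>T = 2 d I - L(\<one>)\<close> on a \<open>d\<close>-regular graph, and \<open>B \<eta> \<perp> \<one>\<close>, so \<open>|B \<eta>|\<^sup>2\<close> is
  at most \<open>(2 d - \<lambda>\<^sub>2) |\<eta>|\<^sup>2\<close>. On the complete graph every \<open>X\<close> is a Laplacian; one choice of \<open>v\<close> also
  gives a maximizer of the quotient defining \<open>\<mu>\<close>, which proves (2).
\<close>

subsection \<open>Orthonormal eigenbases of real symmetric matrices\<close>

lemma scalar_prod_sum:
  "w \<in> carrier_vec n \<Longrightarrow> v \<bullet> w = (\<Sum>i<n. v $ i * w $ i)"
  by (simp add: scalar_prod_def lessThan_atLeast0)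

lemma bilinear_form_sum:
  fixes A :: "'a :: comm_semiring_0 mat"
  assumes "A \<in> carrier_mat n n" and "w \<in> carrier_vec n"
  shows "v \<bullet> (A *\<^sub>v w) = (\<Sum>i<n. \<Sum>j<n. v $ i * A $$ (i, j) * w $ j)"
proof -
  have "(A *\<^sub>v w) $ i = (\<Sum>j<n. A $$ (i, j) * w $ j)" if "i < n" for i
    using assms that by (simp add: scalar_prod_def lessThan_atLeast0)
  moreover have "A *\<^sub>v w \<in> carrier_vec n"
    using assms by simp
  ultimately show ?thesis
    by (simp add: scalar_prod_sum[where n = n] sum_distrib_left mult.assoc)
qed

lemma symmetric_form_commute:
  fixes A :: "real mat"
  assumes A: "A \<in> carrier_mat n n" and sym: "transpose_mat A = A"
    and v: "v \<in> carrier_vec n" and w: "w \<in> carrier_vec n"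
  shows "v \<bullet> (A *\<^sub>v w) = w \<bullet> (A *\<^sub>v v)"
  using transpose_vec_mult_scalar[OF A w v] sym A v w
  by (metis comm_scalar_prod mult_mat_vec_carrier)

lemma scalar_prod_self_nonneg: "0 \<le> v \<bullet> (v :: real vec)"
  by (simp add: scalar_prod_def sum_nonneg)

lemma scalar_prod_self_pos:
  fixes v :: "real vec"
  assumes "v \<in> carrier_vec n" and "v \<noteq> 0\<^sub>v n"
  shows "0 < v \<bullet> v"
proof -
  obtain i where i: "i < n" "v $ i \<noteq> 0"
    using assms by (metis carrier_vecD eq_vecI index_zero_vec)
  then have "0 < v $ i * v $ i"
    by (metis not_real_square_gt_zero)
  also have "\<dots> \<le> (\<Sum>i<n. v $ i * v $ i)"
    using i by (intro member_le_sum) auto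
  finally show ?thesis
    using assms by (simp add: scalar_prod_sum)
qed

lemma normalize_vec:
  fixes v :: "real vec"
  assumes v: "v \<in> carrier_vec n" and nz: "v \<noteq> 0\<^sub>v n"
  defines "w \<equiv> (1 / sqrt (v \<bullet> v)) \<cdot>\<^sub>v v"
  shows "w \<bullet> w = 1"
  using scalar_prod_self_pos[OF v nz] v by (simp add: w_def)

text \<open>The unit sphere of the orthogonal complement of \<open>U\<close> is compact, so the
  quadratic form attains its maximum there. Compactness is argued for functions
  \<open>nat \<Rightarrow> real\<close> vanishing outside \<open>{..<n}\<close>, in the product
  topology; the nonzero vector \<open>v\<close> ensures that the sphere is nonempty.\<close>

lemma rayleigh_maximizer:
  fixes A :: "real mat"
  assumes A: "A \<in> carrier_mat n n" and U: "U \<subseteq> carrier_vec n"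
    and v: "v \<in> carrier_vec n" "v \<noteq> 0\<^sub>v n" "\<forall>u\<in>U. u \<bullet> v = 0"
  obtains u where "u \<in> carrier_vec n" "u \<bullet> u = 1" "\<forall>x\<in>U. x \<bullet> u = 0"
    "\<And>w. w \<in> carrier_vec n \<Longrightarrow> \<forall>x\<in>U. x \<bullet> w = 0 \<Longrightarrow>
       w \<bullet> (A *\<^sub>v w) \<le> (u \<bullet> (A *\<^sub>v u)) * (w \<bullet> w)"
proof -
  define F where "F = (\<lambda>g. \<Sum>i<n. \<Sum>j<n. g i * A $$ (i, j) * g j)"
  define K where "K = {g::nat \<Rightarrow> real. (\<forall>i. i \<notin> {..<n} \<longrightarrow> g i = 0) \<and> (\<Sum>i<n. g i * g i) = 1
                        \<and> (\<forall>x. x \<in> U \<longrightarrow> (\<Sum>i<n. x $ i * g i) = 0)}"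
  have cont: "continuous_on UNIV (\<lambda>g::nat \<Rightarrow> real. g e)" for e
    by simp
  have contF: "continuous_on UNIV F"
    unfolding F_def by (intro continuous_intros cont)
  have clK: "closed K"
    unfolding K_def
    by (intro closed_Collect_conj closed_Collect_all closed_Collect_imp closed_Collect_eq
        open_Collect_const continuous_intros cont)
  \<comment> \<open>Unit norm bounds every coordinate by 1, so \<open>K\<close> is a closed subset
    of a cube that is compact by Tychonoff.\<close>
  have box: "K \<subseteq> (\<Pi>\<^sub>E e\<in>UNIV. {-1..1})"
  proof
    fix g assume k: "g \<in> K"
    have "\<bar>g e\<bar> \<le> 1" for e
    proof (cases "e < n")
      case True
      then have "g e * g e \<le> (\<Sum>i<n. g i * g i)"
        by (intro member_le_sum) auto
      with k show ?thesis by (simp add: K_def abs_le_square_iff[of _ 1, simplified] power2_eq_square)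
    qed (use k in \<open>simp add: K_def\<close>)
    then show "g \<in> (\<Pi>\<^sub>E e\<in>UNIV. {-1..1})" by (auto simp: abs_le_iff minus_le_iff)
  qed
  have "compactin (product_topology (\<lambda>_. euclidean) UNIV) (\<Pi>\<^sub>E e\<in>(UNIV :: nat set). {-1..1::real})"
    by (subst compactin_PiE) auto
  then have "compact (\<Pi>\<^sub>E e\<in>(UNIV :: nat set). {-1..1::real})"
    by (simp add: euclidean_product_topology)
  then have "compact K"
    using clK box compact_Int_closed[of _ K] by (metis inf.absorb2)
  then have cFK: "compact (F ` K)"
    using contF compact_continuous_image continuous_on_subset by blast
  have unit: "w \<bullet> (A *\<^sub>v w) \<in> F ` K"
    if w: "w \<in> carrier_vec n" "w \<bullet> w = 1" "\<forall>x\<in>U. x \<bullet> w = 0" for w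
  proof (rule image_eqI)
    let ?g = "\<lambda>i. if i < n then w $ i else 0"
    show "w \<bullet> (A *\<^sub>v w) = F ?g"
      unfolding F_def using A w by (simp add: bilinear_form_sum)
    show "?g \<in> K"
      using w by (simp add: K_def scalar_prod_sum)
  qed
  have scaled: "(w \<bullet> (A *\<^sub>v w)) / (w \<bullet> w) \<in> F ` K"
    if w: "w \<in> carrier_vec n" "w \<noteq> 0\<^sub>v n" "\<forall>x\<in>U. x \<bullet> w = 0" for w
  proof -
    let ?z = "(1 / sqrt (w \<bullet> w)) \<cdot>\<^sub>v w"
    have "?z \<bullet> (A *\<^sub>v ?z) = (w \<bullet> (A *\<^sub>v w)) / (w \<bullet> w)"
      using A w scalar_prod_self_pos[OF w(1,2)] by (simp add: mult_mat_vec[OF A w(1)])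
    moreover have "?z \<bullet> (A *\<^sub>v ?z) \<in> F ` K"
      using w U by (intro unit normalize_vec) (auto simp: scalar_prod_smult_right)
    ultimately show ?thesis
      by simp
  qed
  from cFK scaled[OF v] obtain m where m: "m \<in> F ` K" "\<forall>x\<in>F ` K. x \<le> m"
    using compact_attains_sup by (metis empty_iff)
  then obtain g where g: "g \<in> K" "m = F g"
    by blast
  have sc: "u \<bullet> vec n g = (\<Sum>i<n. u $ i * g i)" for u
    by (simp add: scalar_prod_sum[where n = n])
  have Fg: "vec n g \<bullet> (A *\<^sub>v vec n g) = m"
    using A by (simp add: bilinear_form_sum g F_def)
  show ?thesis
  proof (rule that[of "vec n g"])
    show "vec n g \<bullet> vec n g = 1" "\<forall>x\<in>U. x \<bullet> vec n g = 0"
      using g by (simp_all add: sc K_def)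
    show "w \<bullet> (A *\<^sub>v w) \<le> (vec n g \<bullet> (A *\<^sub>v vec n g)) * (w \<bullet> w)"
      if w: "w \<in> carrier_vec n" "\<forall>x\<in>U. x \<bullet> w = 0" for w
    proof (cases "w = 0\<^sub>v n")
      case True
      then show ?thesis using A by simp
    next
      case False
      then show ?thesis
        using bspec[OF m(2) scaled[of w]] w scalar_prod_self_pos[of w n] unfolding Fg
        by (simp add: pos_divide_le_eq)
    qed
  qed simp
qed

text \<open>A square matrix having the given vectors among its rows and a zero row is singular; any
  nonzero kernel vector is orthogonal to all of them.\<close>

lemma orthogonal_vec_exists:
  fixes us :: "real vec list"
  assumes us: "set us \<subseteq> carrier_vec n" and len: "length us < n"
  obtains v where "v \<in> carrier_vec n" "v \<noteq> 0\<^sub>v n" "\<forall>u\<in>set us. u \<bullet> v = 0"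
proof -
  define c where "c = (\<lambda>i. if i < length us then us ! i else 0\<^sub>v n)"
  \<comment> \<open>The zero row sits at \<open>n - 1\<close>, which no given vector occupies
    because \<open>length us < n\<close>.\<close>
  define M where "M = mat\<^sub>r n n (\<lambda>i. if i = n - 1 then 0\<^sub>v n else c i)"
  have c: "c i \<in> carrier_vec n" for i
    using us by (auto simp: c_def)
  have M: "M \<in> carrier_mat n n"
    by (simp add: M_def)
  have rowM: "row M i = us ! i" if "i < length us" for i
  proof -
    have "i \<noteq> n - 1"
      using that len by linarith
    then show ?thesis
      using that len c[of i] by (auto simp: M_def c_def)
  qed
  have "det M = 0"
    unfolding M_def using len c by (intro det_row_0) auto
  then obtain v where v: "v \<in> carrier_vec n" "v \<noteq> 0\<^sub>v n" "M *\<^sub>v v = 0\<^sub>v n"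
    using det_0_iff_vec_prod_zero_field[OF M] by blast
  have "us ! i \<bullet> v = 0" if "i < length us" for i
    using arg_cong[OF v(3), of "\<lambda>x. x $ i"] that len M rowM[OF that] by simp
  with v that show ?thesis
    by (metis in_set_conv_nth)
qed

text \<open>Take a Rayleigh maximizer \<open>u\<close> on the complement of \<open>U\<close>. By
  symmetry of \<open>A\<close>, the residual \<open>r = A u - l u\<close> stays in that complement,
  since \<open>U\<close> consists of eigenvectors. Moving from \<open>u\<close> along
  \<open>r\<close> increases the form to first order unless \<open>r = 0\<close>.\<close>

lemma eigenvec_orthogonal_to_eigenvecs:
  fixes A :: "real mat"
  assumes A: "A \<in> carrier_mat n n" and sym: "transpose_mat A = A"
    and U: "U \<subseteq> carrier_vec n" and eig: "\<forall>x\<in>U. \<exists>c. A *\<^sub>v x = c \<cdot>\<^sub>v x"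
    and v: "v \<in> carrier_vec n" "v \<noteq> 0\<^sub>v n" "\<forall>u\<in>U. u \<bullet> v = 0"
  obtains u l where "u \<in> carrier_vec n" "u \<bullet> u = 1" "\<forall>x\<in>U. x \<bullet> u = 0" "A *\<^sub>v u = l \<cdot>\<^sub>v u"
proof -
  obtain u where u: "u \<in> carrier_vec n" "u \<bullet> u = 1" "\<forall>x\<in>U. x \<bullet> u = 0"
    and max: "\<And>w. w \<in> carrier_vec n \<Longrightarrow> \<forall>x\<in>U. x \<bullet> w = 0 \<Longrightarrow>
       w \<bullet> (A *\<^sub>v w) \<le> (u \<bullet> (A *\<^sub>v u)) * (w \<bullet> w)"
    using rayleigh_maximizer[OF A U v] by metis
  define l where "l = u \<bullet> (A *\<^sub>v u)"
  define r where "r = A *\<^sub>v u - l \<cdot>\<^sub>v u"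
  define s where "s = r \<bullet> r"
  define b where "b = r \<bullet> (A *\<^sub>v r)"
  have Au: "A *\<^sub>v u \<in> carrier_vec n" and r: "r \<in> carrier_vec n"
    using A u by (auto simp: r_def)
  then have Ar: "A *\<^sub>v r \<in> carrier_vec n"
    using A by auto
  have ur: "u \<bullet> r = 0"
    using u Au by (simp add: r_def scalar_prod_minus_distrib[where n = n] l_def)
  then have ru: "r \<bullet> u = 0"
    using r u by (simp add: comm_scalar_prod)
  have Aur: "A *\<^sub>v u = r + l \<cdot>\<^sub>v u"
    using u A by (intro eq_vecI) (auto simp: r_def)
  have rAu: "r \<bullet> (A *\<^sub>v u) = s"
    using r u ru unfolding Aur s_def by (simp add: scalar_prod_add_distrib[where n = n])
  then have uAr: "u \<bullet> (A *\<^sub>v r) = s"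
    using symmetric_form_commute[OF A sym u(1) r] by simp
  have Ur: "x \<bullet> r = 0" if x: "x \<in> U" for x
  proof -
    obtain c where "A *\<^sub>v x = c \<cdot>\<^sub>v x"
      using eig x by blast
    then have "x \<bullet> (A *\<^sub>v u) = c * (u \<bullet> x)"
      using symmetric_form_commute[OF A sym, of x u] U x u by (auto simp: subset_iff)
    moreover have "u \<bullet> x = 0"
      using u U x by (metis comm_scalar_prod subsetD)
    ultimately show ?thesis
      using u U x Au by (simp add: r_def scalar_prod_minus_distrib[where n = n] subset_iff)
  qed
  \<comment> \<open>Maximality of \<open>u\<close> tested at \<open>u + t r\<close>, whose squared
    norm is \<open>1 + t\<^sup>2 s\<close>; the constant term \<open>l\<close> cancels.\<close>
  have quadratic: "2 * t * s + t * t * b \<le> l * (t * t * s)" for t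
  proof -
    let ?w = "u + t \<cdot>\<^sub>v r"
    have w: "?w \<in> carrier_vec n"
      using u r by simp
    have "x \<bullet> ?w = 0" if "x \<in> U" for x
      using u r U Ur that by (simp add: scalar_prod_add_distrib[where n = n] subset_iff)
    moreover have "?w \<bullet> ?w = 1 + t * t * s"
      using u r ur ru by (simp add: scalar_prod_add_distrib[where n = n]
          add_scalar_prod_distrib[where n = n] s_def)
    moreover have "?w \<bullet> (A *\<^sub>v ?w) = l + 2 * t * s + t * t * b"
      using u r A Au Ar rAu uAr by (simp add: scalar_prod_add_distrib[where n = n]
          add_scalar_prod_distrib[where n = n] mult_add_distrib_mat_vec[OF A] mult_mat_vec[OF A]
          b_def l_def algebra_simps)
    ultimately show ?thesis
      using max[OF w] by (simp add: l_def[symmetric] algebra_simps)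
  qed
  have "s = 0"
  proof (rule ccontr)
    assume "s \<noteq> 0"
    then have s: "0 < s"
      using scalar_prod_self_nonneg[of r] by (simp add: s_def)
    \<comment> \<open>Small enough that the second-order term is at most \<open>s\<close>, against
      the \<open>2 * s\<close> required by \<open>quadratic\<close>; adding 1 keeps the denominator
      positive.\<close>
    define t where "t = s / (\<bar>l * s - b\<bar> + 1)"
    have t: "0 < t"
      using s by (simp add: t_def add_nonneg_pos)
    have "t * (2 * s) \<le> t * (t * (l * s - b))"
      using quadratic[of t] by (simp add: algebra_simps)
    then have "2 * s \<le> t * (l * s - b)"
      using t by simp
    also have "\<dots> \<le> t * (\<bar>l * s - b\<bar> + 1)"
      using t by (intro mult_left_mono) auto
    also have "\<dots> = s"
      unfolding t_def by (simp add: add_nonneg_pos less_imp_neq[symmetric] add_pos_nonneg)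
    finally show False
      using s by simp
  qed
  then have "r = 0\<^sub>v n"
    using scalar_prod_self_pos[OF r] by (auto simp: s_def)
  then have "A *\<^sub>v u = l \<cdot>\<^sub>v u"
    using Aur u by simp
  with u that show ?thesis
    by blast
qed

text \<open>The eigenvalue of a unit eigenvector is recorded as its Rayleigh value, so no separate
  list of eigenvalues has to be carried along.\<close>

definition orthonormal_eigenvecs :: "nat \<Rightarrow> real mat \<Rightarrow> real vec list \<Rightarrow> bool" where
  "orthonormal_eigenvecs n A us \<longleftrightarrow> set us \<subseteq> carrier_vec n \<and>
     (\<forall>i<length us. \<forall>j<length us. us ! i \<bullet> us ! j = (if i = j then 1 else 0)) \<and>
     (\<forall>u\<in>set us. A *\<^sub>v u = (u \<bullet> (A *\<^sub>v u)) \<cdot>\<^sub>v u)"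

lemma orthonormal_eigenvecs_snoc:
  assumes us: "orthonormal_eigenvecs n A us"
    and u: "u \<in> carrier_vec n" "u \<bullet> u = 1" "\<forall>x\<in>set us. x \<bullet> u = 0" "A *\<^sub>v u = l \<cdot>\<^sub>v u"
  shows "orthonormal_eigenvecs n A (us @ [u])"
proof -
  have "u \<bullet> x = 0" if "x \<in> set us" for x
    using u us that unfolding orthonormal_eigenvecs_def by (metis comm_scalar_prod subsetD)
  moreover have "A *\<^sub>v u = (u \<bullet> (A *\<^sub>v u)) \<cdot>\<^sub>v u"
    using u by simp
  ultimately show ?thesis
    using us u(1-3) unfolding orthonormal_eigenvecs_def
    by (auto simp: nth_append less_Suc_eq)
qed

text \<open>Adds one eigenvector at a time in the complement of those already present. Starting from
  a given list makes it possible to prescribe the first members of the basis, later the normalized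
  all-ones vector.\<close>

lemma orthonormal_eigenvecs_extend:
  fixes A :: "real mat"
  assumes A: "A \<in> carrier_mat n n" and sym: "transpose_mat A = A"
    and us: "orthonormal_eigenvecs n A us" and len: "length us \<le> n"
  shows "\<exists>vs. orthonormal_eigenvecs n A (us @ vs) \<and> length (us @ vs) = n"
  using us len
proof (induction "n - length us" arbitrary: us)
  case 0
  then show ?case
    by (intro exI[of _ "[]"]) simp
next
  case (Suc k)
  then have lt: "length us < n" and U: "set us \<subseteq> carrier_vec n"
    by (auto simp: orthonormal_eigenvecs_def)
  obtain v where v: "v \<in> carrier_vec n" "v \<noteq> 0\<^sub>v n" "\<forall>u\<in>set us. u \<bullet> v = 0"
    using orthogonal_vec_exists[OF U lt] by blast
  have "\<forall>x\<in>set us. \<exists>c. A *\<^sub>v x = c \<cdot>\<^sub>v x"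
    using Suc.prems(1) unfolding orthonormal_eigenvecs_def by blast
  from eigenvec_orthogonal_to_eigenvecs[OF A sym U this v] obtain u l where
    "u \<in> carrier_vec n" "u \<bullet> u = 1" "\<forall>x\<in>set us. x \<bullet> u = 0" "A *\<^sub>v u = l \<cdot>\<^sub>v u"
    by metis
  then have "orthonormal_eigenvecs n A (us @ [u])"
    using Suc.prems(1) by (rule orthonormal_eigenvecs_snoc[rotated])
  moreover have "k = n - length (us @ [u])" "length (us @ [u]) \<le> n"
    using Suc.hyps(2) lt by auto
  ultimately obtain vs where
    "orthonormal_eigenvecs n A ((us @ [u]) @ vs)" "length ((us @ [u]) @ vs) = n"
    using Suc.hyps(1) by blast
  then show ?case
    by (intro exI[of _ "u # vs"]) simp
qed

text \<open>The matrix \<open>W\<close> with rows \<open>us\<close> is orthogonal and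
  \<open>A = W\<^sup>T D W\<close> with \<open>D\<close> diagonal. Similarity gives the spectrum
  with multiplicities, and passing to the coordinates \<open>W v\<close> gives the two
  expansions.\<close>

lemma orthonormal_eigenbasis:
  fixes A :: "real mat"
  assumes A: "A \<in> carrier_mat n n" and us: "orthonormal_eigenvecs n A us" and len: "length us = n"
  shows sorted_eigenvalues_eigenbasis:
      "sorted_eigenvalues A = sort (map (\<lambda>u. u \<bullet> (A *\<^sub>v u)) us)"
    and parseval: "v \<in> carrier_vec n \<Longrightarrow> v \<bullet> v = (\<Sum>k<n. (us ! k \<bullet> v)\<^sup>2)"
    and quadratic_form_eigenbasis: "v \<in> carrier_vec n \<Longrightarrow>
      v \<bullet> (A *\<^sub>v v) = (\<Sum>k<n. (us ! k \<bullet> (A *\<^sub>v us ! k)) * (us ! k \<bullet> v)\<^sup>2)"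
proof -
  define d where "d = (\<lambda>k. us ! k \<bullet> (A *\<^sub>v us ! k))"
  define D where "D = mat n n (\<lambda>(i, j). if i = j then d i else 0)"
  define W where "W = mat_of_rows n us"
  let ?T = "transpose_mat W"
  have uc: "us ! k \<in> carrier_vec n" if "k < n" for k
    using us len that by (auto simp: orthonormal_eigenvecs_def subset_iff)
  have W: "W \<in> carrier_mat n n" and D: "D \<in> carrier_mat n n" and T: "?T \<in> carrier_mat n n"
    using len by (auto simp: W_def D_def)
  have rowW: "row W k = us ! k" if "k < n" for k
    using that len uc by (simp add: W_def)
  have WT: "W * ?T = 1\<^sub>m n"
    using us len W rowW by (intro eq_matI) (auto simp: orthonormal_eigenvecs_def)
  then have TW: "?T * W = 1\<^sub>m n"
    using mat_mult_left_right_inverse[OF W T] by simp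
  have AT: "A * ?T = ?T * D"
  proof (rule eq_matI)
    fix i j assume "i < dim_row (?T * D)" "j < dim_col (?T * D)"
    then have ij: "i < n" "j < n"
      using W D by auto
    have "(A * ?T) $$ (i, j) = (A *\<^sub>v us ! j) $ i"
      using ij A W rowW by simp
    also have "A *\<^sub>v us ! j = d j \<cdot>\<^sub>v us ! j"
      using us len ij by (simp add: orthonormal_eigenvecs_def d_def)
    also have "(d j \<cdot>\<^sub>v us ! j) $ i = W $$ (j, i) * d j"
      using ij uc[of j] len by (simp add: W_def mat_of_rows_index)
    also have "\<dots> = (?T * D) $$ (i, j)"
      using ij W D by (simp add: scalar_prod_def D_def sum.delta if_distrib cong: if_cong)
    finally show "(A * ?T) $$ (i, j) = (?T * D) $$ (i, j)" .
  qed (use A D W in auto)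
  have AD: "A = ?T * D * W"
    using A W T D TW AT by (metis assoc_mult_mat right_mult_one_mat)
  have "char_poly A = char_poly D"
    by (intro char_poly_similar similar_matI[OF _ TW WT AD]) (use A D W in auto)
  also have "\<dots> = (\<Prod>a\<leftarrow>diag_mat D. [:- a, 1:])"
    by (intro char_poly_upper_triangular[OF D]) (auto simp: D_def)
  also have "diag_mat D = map (\<lambda>u. u \<bullet> (A *\<^sub>v u)) us" (is "_ = ?ds")
    using len D by (intro nth_equalityI) (auto simp: diag_mat_def D_def d_def)
  finally have cp: "char_poly A = (\<Prod>a\<leftarrow>?ds. [:- a, 1:])" .
  \<comment> \<open>The multiset of roots of a product of linear factors keeps repetitions, so
    multiple eigenvalues are counted correctly.\<close>
  have "proots (\<Prod>a\<leftarrow>xs. [:- a, 1:]) = mset xs" for xs :: "real list"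
  proof (induction xs)
    case (Cons x xs)
    have "(\<Prod>a\<leftarrow>xs. [:- a, 1:]) \<noteq> 0"
      by (auto simp: prod_list_zero_iff)
    then show ?case
      using Cons by (simp add: proots_mult del: mult_pCons_left)
  qed simp
  then show "sorted_eigenvalues A = sort ?ds"
    unfolding sorted_eigenvalues_def cp by (metis mset_map sorted_list_of_multiset_mset)
  assume v: "v \<in> carrier_vec n"
  then have Wv: "W *\<^sub>v v \<in> carrier_vec n"
    using W by simp
  have Wvk: "(W *\<^sub>v v) $ k = us ! k \<bullet> v" if "k < n" for k
    using that W rowW by simp
  have moveT: "v \<bullet> (?T *\<^sub>v w) = (W *\<^sub>v v) \<bullet> w" if w: "w \<in> carrier_vec n" for w
    using transpose_vec_mult_scalar[OF W v w] w v W T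
    by (metis comm_scalar_prod mult_mat_vec_carrier)
  have "v = ?T *\<^sub>v (W *\<^sub>v v)"
    using TW T W v by (metis assoc_mult_mat_vec one_mult_mat_vec)
  then have "v \<bullet> v = (W *\<^sub>v v) \<bullet> (W *\<^sub>v v)"
    using moveT[OF Wv] by metis
  then show "v \<bullet> v = (\<Sum>k<n. (us ! k \<bullet> v)\<^sup>2)"
    using Wv Wvk by (simp add: scalar_prod_sum[where n = n] power2_eq_square)
  have "A *\<^sub>v v = ?T *\<^sub>v (D *\<^sub>v (W *\<^sub>v v))"
    using T D W v by (subst AD) (simp add: assoc_mult_mat_vec[of _ n n _ n])
  then have "v \<bullet> (A *\<^sub>v v) = (W *\<^sub>v v) \<bullet> (D *\<^sub>v (W *\<^sub>v v))"
    using moveT D Wv by simp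
  also have "\<dots> = (\<Sum>i<n. \<Sum>j<n. if i = j then d i * (us ! i \<bullet> v)\<^sup>2 else 0)"
    unfolding bilinear_form_sum[OF D Wv]
    by (intro sum.cong refl) (simp add: D_def Wvk power2_eq_square del: index_mult_mat_vec)
  also have "\<dots> = (\<Sum>k<n. d k * (us ! k \<bullet> v)\<^sup>2)"
    by (intro sum.cong refl) simp
  finally show "v \<bullet> (A *\<^sub>v v) = (\<Sum>k<n. (us ! k \<bullet> (A *\<^sub>v us ! k)) * (us ! k \<bullet> v)\<^sup>2)"
    by (simp add: d_def)
qed

subsection \<open>Weighted Laplacians and incidence sums\<close>

lemma simple_graph_finite: "simple_graph N Es \<Longrightarrow> finite Es"
  unfolding simple_graph_def by (rule finite_subset[of _ "Pow {..<N}"]) auto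

lemma simple_graph_edgeD:
  assumes "simple_graph N Es" and "{i, j} \<in> Es"
  shows "i \<noteq> j" "i < N" "j < N"
proof -
  have "{i, j} \<subseteq> {..<N}" "card {i, j} = 2"
    using assms by (auto simp: simple_graph_def)
  then show "i \<noteq> j" "i < N" "j < N"
    by auto
qed

lemma simple_graph_edgeE:
  assumes "simple_graph N Es" and "e \<in> Es"
  obtains i j where "e = {i, j}" "i \<noteq> j" "i < N" "j < N"
proof -
  have "e \<subseteq> {..<N}" "card e = 2"
    using assms by (auto simp: simple_graph_def)
  moreover from this obtain i j where "e = {i, j}" "i \<noteq> j"
    by (meson card_2_iff)
  ultimately show ?thesis
    using that by simp
qed

text \<open>The unsigned incidence operator \<open>\<real>\<^sup>E \<Rightarrow> \<real>\<^sup>N\<close>.\<close>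

definition incident_sum :: "nat set set \<Rightarrow> (nat set \<Rightarrow> real) \<Rightarrow> nat \<Rightarrow> real" where
  "incident_sum Es f i = (\<Sum>e\<in>Es. if i \<in> e then f e else 0)"

text \<open>The map from \<open>j\<close> to \<open>{i, j}\<close> is a bijection from the
  neighbours of \<open>i\<close> to the edges at \<open>i\<close>.\<close>

lemma sum_neighbours:
  fixes f :: "nat set \<Rightarrow> real"
  assumes G: "simple_graph N Es"
  shows "(\<Sum>j<N. if {i, j} \<in> Es then f {i, j} else 0) = incident_sum Es f i"
proof -
  have "bij_betw (\<lambda>j. {i, j}) {j \<in> {..<N}. {i, j} \<in> Es} {e \<in> Es. i \<in> e}"
    unfolding bij_betw_def
  proof
    show "inj_on (\<lambda>j. {i, j}) {j \<in> {..<N}. {i, j} \<in> Es}"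
      by (auto simp: inj_on_def doubleton_eq_iff)
    show "(\<lambda>j. {i, j}) ` {j \<in> {..<N}. {i, j} \<in> Es} = {e \<in> Es. i \<in> e}"
    proof (intro equalityI subsetI)
      fix e assume "e \<in> {e \<in> Es. i \<in> e}"
      then have e: "e \<in> Es" "i \<in> e"
        by auto
      then obtain k l where kl: "e = {k, l}" "k < N" "l < N"
        using simple_graph_edgeE[OF G] by metis
      then have "\<exists>j<N. e = {i, j}"
        using e by (cases "i = k") (auto simp: insert_commute)
      then show "e \<in> (\<lambda>j. {i, j}) ` {j \<in> {..<N}. {i, j} \<in> Es}"
        using e by auto
    qed auto
  qed
  then have "(\<Sum>j | j \<in> {..<N} \<and> {i, j} \<in> Es. f {i, j}) = (\<Sum>e | e \<in> Es \<and> i \<in> e. f e)"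
    by (rule sum.reindex_bij_betw)
  then show ?thesis
    using simple_graph_finite[OF G] by (simp add: incident_sum_def sum.inter_filter del: lessThan_iff)
qed

text \<open>Adjointness by double counting: the transpose of the incidence operator sends
  \<open>y\<close> to the sum of its values at the endpoints of each edge.\<close>

lemma sum_mult_incident_sum:
  assumes G: "simple_graph N Es"
  shows "(\<Sum>i<N. y i * incident_sum Es f i) = (\<Sum>e\<in>Es. f e * (\<Sum>i\<in>e. y i))"
proof -
  have "(\<Sum>i<N. if i \<in> e then y i * f e else 0) = f e * (\<Sum>i\<in>e. y i)" if "e \<in> Es" for e
  proof -
    have "{..<N} \<inter> e = e"
      using G that by (auto simp: simple_graph_def)
    then show ?thesis
      by (simp add: sum.inter_restrict[symmetric] sum_distrib_left mult.commute)
  qed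
  then show ?thesis
    unfolding incident_sum_def sum_distrib_left
    by (subst sum.swap) (simp add: if_distrib cong: if_cong)
qed

lemma sum_incident_sum:
  assumes G: "simple_graph N Es"
  shows "(\<Sum>i<N. incident_sum Es f i) = 2 * (\<Sum>e\<in>Es. f e)"
  using sum_mult_incident_sum[OF G, of "\<lambda>_. 1" f] G
  by (simp add: simple_graph_def sum_distrib_right[symmetric])

lemma sum_adjacent_pairs:
  fixes f :: "nat set \<Rightarrow> real"
  assumes G: "simple_graph N Es"
  shows "(\<Sum>i<N. \<Sum>j<N. if {i, j} \<in> Es then f {i, j} else 0) = 2 * (\<Sum>e\<in>Es. f e)"
  by (simp add: sum_neighbours[OF G] sum_incident_sum[OF G])

lemma laplacian_carrier [simp]: "laplacian N Es \<gamma> \<in> carrier_mat N N"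
  by (simp add: laplacian_def)

lemma laplacian_dim [simp]:
  "dim_row (laplacian N Es \<gamma>) = N" "dim_col (laplacian N Es \<gamma>) = N"
  by (simp_all add: laplacian_def)

lemma laplacian_index:
  assumes G: "simple_graph N Es" and ij: "i < N" "j < N"
  shows "laplacian N Es \<gamma> $$ (i, j) =
    (if i = j then incident_sum Es \<gamma> i else 0) - (if {i, j} \<in> Es then \<gamma> {i, j} else 0)"
proof -
  have "(\<Sum>k | k < N \<and> {i, k} \<in> Es. \<gamma> {i, k}) = incident_sum Es \<gamma> i"
    using sum.inter_filter[of "{..<N}" "\<lambda>k. \<gamma> {i, k}" "\<lambda>k. {i, k} \<in> Es"]
    by (simp add: sum_neighbours[OF G])
  then show ?thesis
    using ij simple_graph_edgeD(1)[OF G, of i j] by (auto simp: laplacian_def)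
qed

lemma laplacian_symmetric: "transpose_mat (laplacian N Es \<gamma>) = laplacian N Es \<gamma>"
  by (intro eq_matI) (auto simp: laplacian_def insert_commute)

lemma laplacian_mult_vec:
  assumes G: "simple_graph N Es" and v: "v \<in> carrier_vec N" and i: "i < N"
  shows "(laplacian N Es \<gamma> *\<^sub>v v) $ i =
    (\<Sum>j<N. if {i, j} \<in> Es then \<gamma> {i, j} * (v $ i - v $ j) else 0)"
proof -
  have "(laplacian N Es \<gamma> *\<^sub>v v) $ i = (\<Sum>j<N. laplacian N Es \<gamma> $$ (i, j) * v $ j)"
    using v i by (simp add: scalar_prod_sum[OF v])
  also have "\<dots> = (\<Sum>j<N. (if i = j then incident_sum Es \<gamma> i * v $ i else 0)
      - (if {i, j} \<in> Es then \<gamma> {i, j} * v $ j else 0))"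
    using i by (intro sum.cong) (auto simp: laplacian_index[OF G] left_diff_distrib)
  also have "\<dots> = (\<Sum>j<N. if {i, j} \<in> Es then \<gamma> {i, j} else 0) * v $ i
      - (\<Sum>j<N. if {i, j} \<in> Es then \<gamma> {i, j} * v $ j else 0)"
    using i by (simp add: sum_subtractf sum_neighbours[OF G])
  also have "\<dots> = (\<Sum>j<N. if {i, j} \<in> Es then \<gamma> {i, j} * (v $ i - v $ j) else 0)"
    unfolding sum_distrib_right sum_subtractf[symmetric]
    by (intro sum.cong) (auto simp: algebra_simps)
  finally show ?thesis .
qed

lemma laplacian_row_sum:
  assumes G: "simple_graph N Es" and i: "i < N"
  shows "(\<Sum>j<N. laplacian N Es \<gamma> $$ (i, j)) = 0"
  using i by (simp add: laplacian_index[OF G] sum_subtractf sum_neighbours[OF G])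

lemma laplacian_trace:
  assumes G: "simple_graph N Es"
  shows "(\<Sum>i<N. laplacian N Es \<gamma> $$ (i, i)) = 2 * (\<Sum>e\<in>Es. \<gamma> e)"
proof -
  have "{i} \<notin> Es" for i
    using simple_graph_edgeD(1)[OF G, of i i] by auto
  then show ?thesis
    by (simp add: laplacian_index[OF G] sum_incident_sum[OF G])
qed

text \<open>For an edge with endpoint values \<open>a\<close> and \<open>b\<close>, the bracket is
  \<open>2 (a\<^sup>2 + b\<^sup>2) - (a + b)\<^sup>2 = (a - b)\<^sup>2\<close>. Writing it with sums
  over \<open>e\<close> avoids choosing an orientation of the edge.\<close>

lemma laplacian_quadratic_form:
  assumes G: "simple_graph N Es" and v: "v \<in> carrier_vec N"
  shows "v \<bullet> (laplacian N Es \<gamma> *\<^sub>v v) =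
    (\<Sum>e\<in>Es. \<gamma> e * (2 * (\<Sum>i\<in>e. (v $ i)\<^sup>2) - (\<Sum>i\<in>e. v $ i)\<^sup>2))"
proof -
  \<comment> \<open>By polarization this is \<open>\<gamma> e\<close> times the product of the two
    endpoint values, again as a function of the unordered edge.\<close>
  define f where "f e = \<gamma> e * ((\<Sum>i\<in>e. v $ i)\<^sup>2 - (\<Sum>i\<in>e. (v $ i)\<^sup>2)) / 2" for e
  have "{i} \<notin> Es" for i
    using simple_graph_edgeD(1)[OF G, of i i] by auto
  moreover have f: "f {i, j} = \<gamma> {i, j} * (v $ i * v $ j)" if "{i, j} \<in> Es" for i j
    using simple_graph_edgeD(1)[OF G that] by (simp add: f_def power2_eq_square algebra_simps)
  ultimately have "v \<bullet> (laplacian N Es \<gamma> *\<^sub>v v) =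
      (\<Sum>i<N. \<Sum>j<N. (if i = j then (v $ i)\<^sup>2 * incident_sum Es \<gamma> i else 0)
         - (if {i, j} \<in> Es then f {i, j} else 0))"
    unfolding bilinear_form_sum[OF laplacian_carrier v]
    by (intro sum.cong refl) (auto simp: laplacian_index[OF G] f power2_eq_square algebra_simps)
  also have "\<dots> = (\<Sum>i<N. (v $ i)\<^sup>2 * incident_sum Es \<gamma> i) - 2 * (\<Sum>e\<in>Es. f e)"
    by (simp add: sum_subtractf sum_adjacent_pairs[OF G])
  also have "\<dots> = (\<Sum>e\<in>Es. \<gamma> e * (2 * (\<Sum>i\<in>e. (v $ i)\<^sup>2) - (\<Sum>i\<in>e. v $ i)\<^sup>2))"
    unfolding sum_mult_incident_sum[OF G] sum_distrib_left sum_subtractf[symmetric]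
    by (intro sum.cong refl) (simp add: f_def sum_distrib_left[symmetric] field_simps)
  finally show ?thesis .
qed

lemma laplacian_nonneg:
  assumes G: "simple_graph N Es" and v: "v \<in> carrier_vec N" and "\<And>e. e \<in> Es \<Longrightarrow> 0 \<le> \<gamma> e"
  shows "0 \<le> v \<bullet> (laplacian N Es \<gamma> *\<^sub>v v)"
  unfolding laplacian_quadratic_form[OF G v]
proof (intro sum_nonneg mult_nonneg_nonneg assms(3))
  fix e assume "e \<in> Es"
  then obtain i j where e: "e = {i, j}" "i \<noteq> j"
    using simple_graph_edgeE[OF G] by metis
  have "2 * (\<Sum>i\<in>e. (v $ i)\<^sup>2) - (\<Sum>i\<in>e. v $ i)\<^sup>2 = (v $ i - v $ j)\<^sup>2"
    using e by (simp add: power2_eq_square algebra_simps)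
  then show "0 \<le> 2 * (\<Sum>i\<in>e. (v $ i)\<^sup>2) - (\<Sum>i\<in>e. v $ i)\<^sup>2"
    by simp
qed

section \<open>Frobenius norms, the line graph and Cauchy-Schwarz\<close>

lemma laplacian_frobenius:
  assumes G: "simple_graph N Es"
  shows "(\<Sum>i<N. \<Sum>j<N. (laplacian N Es \<gamma> $$ (i, j))\<^sup>2) =
    (\<Sum>i<N. (incident_sum Es \<gamma> i)\<^sup>2) + 2 * (\<Sum>e\<in>Es. (\<gamma> e)\<^sup>2)"
proof -
  have "{i} \<notin> Es" for i
    using simple_graph_edgeD(1)[OF G, of i i] by auto
  then have "(\<Sum>i<N. \<Sum>j<N. (laplacian N Es \<gamma> $$ (i, j))\<^sup>2) =
      (\<Sum>i<N. \<Sum>j<N. (if i = j then (incident_sum Es \<gamma> i)\<^sup>2 else 0)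
         + (if {i, j} \<in> Es then (\<gamma> {i, j})\<^sup>2 else 0))"
    by (intro sum.cong refl) (auto simp: laplacian_index[OF G])
  then show ?thesis
    by (simp add: sum.distrib sum_adjacent_pairs[OF G, of "\<lambda>e. (\<gamma> e)\<^sup>2"])
qed

text \<open>The entries of \<open>B\<^sup>T B\<close> are the numbers
  \<open>card (e \<inter> f)\<close>: 2 on the diagonal, 1 for edges sharing one vertex, 0
  otherwise. Hence \<open>4 I + A = B\<^sup>T B + 2 I\<close>, and the form equals the squared
  Frobenius norm computed in \<open>laplacian_frobenius\<close>.\<close>

lemma four_plus_line_adj_form:
  assumes G: "simple_graph N Es"
  shows "edge_inner Es \<eta> (four_plus_line_adj Es \<eta>) =
    (\<Sum>i<N. (incident_sum Es \<eta> i)\<^sup>2) + 2 * (\<Sum>e\<in>Es. (\<eta> e)\<^sup>2)"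
proof -
  note fin = simple_graph_finite[OF G]
  have coeff: "4 * (if e = f then 1 else 0) + adjacency (line_graph Es) e f =
      real (card (e \<inter> f)) + (if e = f then 2 else 0)" if "e \<in> Es" "f \<in> Es" for e f
  proof -
    obtain i j where e: "e = {i, j}" "i \<noteq> j"
      using simple_graph_edgeE[OF G \<open>e \<in> Es\<close>] by metis
    obtain k l where f: "f = {k, l}" "k \<noteq> l"
      using simple_graph_edgeE[OF G \<open>f \<in> Es\<close>] by metis
    have adj: "{e, f} \<in> line_graph Es \<longleftrightarrow> e \<noteq> f \<and> e \<inter> f \<noteq> {}"
      using that by (auto simp: line_graph_def doubleton_eq_iff)
    show ?thesis
      unfolding adjacency_def adj using e f by (auto simp: Int_insert_left doubleton_eq_iff)
  qed
  have inc: "(\<Sum>i\<in>e. incident_sum Es \<eta> i) = (\<Sum>f\<in>Es. real (card (e \<inter> f)) * \<eta> f)"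
    if "e \<in> Es" for e
  proof -
    have "finite e"
      using simple_graph_edgeE[OF G that] by auto
    then show ?thesis
      unfolding incident_sum_def by (subst sum.swap) (simp add: sum.inter_restrict[symmetric])
  qed
  have "four_plus_line_adj Es \<eta> e = (\<Sum>i\<in>e. incident_sum Es \<eta> i) + 2 * \<eta> e" if e: "e \<in> Es" for e
  proof -
    have "four_plus_line_adj Es \<eta> e =
        (\<Sum>f\<in>Es. real (card (e \<inter> f)) * \<eta> f + (if e = f then 2 * \<eta> f else 0))"
      unfolding four_plus_line_adj_def
      by (intro sum.cong refl, subst coeff[OF e]) (auto simp: algebra_simps)
    then show ?thesis
      using fin e by (simp add: sum.distrib inc)
  qed
  then have "edge_inner Es \<eta> (four_plus_line_adj Es \<eta>) =
      (\<Sum>e\<in>Es. \<eta> e * (\<Sum>i\<in>e. incident_sum Es \<eta> i)) + 2 * (\<Sum>e\<in>Es. (\<eta> e)\<^sup>2)"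
    unfolding edge_inner_def sum_distrib_left[of 2]
    by (simp add: sum.distrib[symmetric] power2_eq_square algebra_simps)
  also have "(\<Sum>e\<in>Es. \<eta> e * (\<Sum>i\<in>e. incident_sum Es \<eta> i)) = (\<Sum>i<N. (incident_sum Es \<eta> i)\<^sup>2)"
    using sum_mult_incident_sum[OF G, of "incident_sum Es \<eta>" \<eta>] by (simp add: power2_eq_square)
  finally show ?thesis .
qed

lemma Cauchy_Schwarz_sum:
  fixes f g :: "'a \<Rightarrow> real"
  shows "(\<Sum>i\<in>I. f i * g i)\<^sup>2 \<le> (\<Sum>i\<in>I. (f i)\<^sup>2) * (\<Sum>i\<in>I. (g i)\<^sup>2)"
proof -
  have "\<bar>\<Sum>i\<in>I. f i * g i\<bar> \<le> (\<Sum>i\<in>I. \<bar>f i\<bar> * \<bar>g i\<bar>)"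
    using sum_abs[of "\<lambda>i. f i * g i" I] by (simp add: abs_mult)
  also have "\<dots> \<le> L2_set f I * L2_set g I"
    by (rule L2_set_mult_ineq)
  finally have "(\<Sum>i\<in>I. f i * g i)\<^sup>2 \<le> (L2_set f I * L2_set g I)\<^sup>2"
    by (metis abs_le_square_iff abs_of_nonneg L2_set_nonneg mult_nonneg_nonneg)
  then show ?thesis
    by (simp add: L2_set_def power_mult_distrib sum_nonneg)
qed

text \<open>Cauchy-Schwarz applied to \<open>v v\<^sup>T\<close> itself would give only the factor
  1. Its component along the projection \<open>P\<close> does not contribute to the Frobenius
  product with \<open>A\<close>, and removing it lowers the squared norm to
  \<open>(N - 2) / (N - 1)\<close>.\<close>

lemma quadratic_form_le_frobenius:
  fixes A :: "real mat"
  assumes A: "A \<in> carrier_mat N N" and N: "2 \<le> N"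
    and row: "\<And>i. i < N \<Longrightarrow> (\<Sum>j<N. A $$ (i, j)) = 0" and trace: "(\<Sum>i<N. A $$ (i, i)) = 0"
    and v: "v \<in> carrier_vec N" "v \<bullet> v = 1" "(\<Sum>i<N. v $ i) = 0"
  shows "(v \<bullet> (A *\<^sub>v v))\<^sup>2 \<le> (real N - 2) / (real N - 1) * (\<Sum>i<N. \<Sum>j<N. (A $$ (i, j))\<^sup>2)"
proof -
  \<comment> \<open>\<open>X\<close> is the projection of \<open>v v\<^sup>T\<close> to the trace-free symmetric matrices that kill the
    all-ones vector, so that \<open>A\<close> has the same Frobenius product with both.\<close>
  define P where "P = (\<lambda>i j :: nat. (if i = j then 1 else 0) - 1 / real N)"
  define X where "X = (\<lambda>i j. v $ i * v $ j - P i j / (real N - 1))"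
  have vv: "(\<Sum>i<N. v $ i * v $ i) = 1"
    using v by (simp add: scalar_prod_sum[where n = N])
  \<comment> \<open>The zero row sums eliminate the constant part of \<open>P\<close>, and what
    remains is the trace of \<open>A\<close>.\<close>
  have AP: "(\<Sum>i<N. \<Sum>j<N. A $$ (i, j) * P i j) = 0"
  proof -
    have "(\<Sum>j<N. A $$ (i, j) * P i j) = A $$ (i, i)" if "i < N" for i
    proof -
      have "(\<Sum>j<N. A $$ (i, j) * P i j) =
          (\<Sum>j<N. (if i = j then A $$ (i, i) else 0) - A $$ (i, j) / real N)"
        by (intro sum.cong refl) (simp add: P_def right_diff_distrib)
      also have "\<dots> = A $$ (i, i)"
        using that row[OF that] by (simp add: sum_subtractf sum_divide_distrib[symmetric])
      finally show ?thesis .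
    qed
    then show ?thesis
      using trace by simp
  qed
  have vP: "(\<Sum>i<N. \<Sum>j<N. v $ i * v $ j * P i j) = 1"
  proof -
    have "(\<Sum>j<N. v $ i * v $ j * P i j) = v $ i * v $ i" if "i < N" for i
    proof -
      have "(\<Sum>j<N. v $ i * v $ j * P i j) =
          (\<Sum>j<N. (if i = j then v $ i * v $ i else 0) - v $ i / real N * v $ j)"
        by (intro sum.cong refl) (simp add: P_def right_diff_distrib)
      also have "\<dots> = v $ i * v $ i"
        using that v
        by (simp add: sum_subtractf sum_distrib_left[symmetric] sum_divide_distrib[symmetric])
      finally show ?thesis .
    qed
    then show ?thesis
      using vv by simp
  qed
  have PP: "(\<Sum>i<N. \<Sum>j<N. P i j * P i j) = real N - 1"
  proof -
    have "(\<Sum>j<N. P i j * P i j) = 1 - 1 / real N" if "i < N" for i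
    proof -
      have "(\<Sum>j<N. P i j * P i j) =
          (\<Sum>j<N. (if i = j then 1 - 2 / real N else 0) + 1 / (real N * real N))"
        by (intro sum.cong refl) (simp add: P_def algebra_simps)
      also have "\<dots> = 1 - 1 / real N"
        using that by (simp add: sum.distrib)
      finally show ?thesis .
    qed
    then have "(\<Sum>i<N. \<Sum>j<N. P i j * P i j) = (\<Sum>i<N. 1 - 1 / real N)"
      by simp
    also have "\<dots> = real N - 1"
      using N by (simp add: right_diff_distrib)
    finally show ?thesis .
  qed
  have vvvv: "(\<Sum>i<N. \<Sum>j<N. (v $ i * v $ j) * (v $ i * v $ j)) = 1"
  proof -
    have "(\<Sum>i<N. \<Sum>j<N. (v $ i * v $ j) * (v $ i * v $ j)) =
        (\<Sum>i<N. v $ i * v $ i) * (\<Sum>j<N. v $ j * v $ j)"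
      unfolding sum_product by (intro sum.cong refl) (simp add: algebra_simps)
    then show ?thesis
      by (simp add: vv)
  qed
  have AX: "(\<Sum>i<N. \<Sum>j<N. A $$ (i, j) * X i j) = v \<bullet> (A *\<^sub>v v)"
  proof -
    have "(\<Sum>i<N. \<Sum>j<N. A $$ (i, j) * X i j) = (\<Sum>i<N. \<Sum>j<N. v $ i * A $$ (i, j) * v $ j)
        - (\<Sum>i<N. \<Sum>j<N. A $$ (i, j) * P i j) / (real N - 1)"
      unfolding sum_divide_distrib sum_subtractf[symmetric]
      by (intro sum.cong refl) (simp add: X_def algebra_simps)
    then show ?thesis
      using AP by (simp add: bilinear_form_sum[OF A v(1)])
  qed
  \<comment> \<open>Expanding the square with \<open>vvvv\<close>, \<open>vP\<close> and
    \<open>PP\<close> gives \<open>1 - 2 / (N - 1) + 1 / (N - 1)\<close>.\<close>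
  have XX: "(\<Sum>i<N. \<Sum>j<N. (X i j)\<^sup>2) = (real N - 2) / (real N - 1)"
  proof -
    have "(\<Sum>i<N. \<Sum>j<N. (X i j)\<^sup>2) = (\<Sum>i<N. \<Sum>j<N. (v $ i * v $ j) * (v $ i * v $ j))
        - 2 / (real N - 1) * (\<Sum>i<N. \<Sum>j<N. v $ i * v $ j * P i j)
        + 1 / (real N - 1)\<^sup>2 * (\<Sum>i<N. \<Sum>j<N. P i j * P i j)"
      unfolding sum_distrib_left sum_subtractf[symmetric] sum.distrib[symmetric]
      by (intro sum.cong refl) (simp add: X_def power2_eq_square algebra_simps)
    moreover have "1 - 2 / n * 1 + 1 / n\<^sup>2 * n = (n - 1) / n" if "n \<noteq> 0" for n :: real
      using that by (simp add: power2_eq_square field_simps)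
    ultimately show ?thesis
      using N unfolding vvvv vP PP by simp
  qed
  have "(v \<bullet> (A *\<^sub>v v))\<^sup>2 = (\<Sum>p\<in>{..<N} \<times> {..<N}. X (fst p) (snd p) * A $$ p)\<^sup>2"
    unfolding AX[symmetric] by (simp add: sum.cartesian_product case_prod_beta mult.commute)
  also have "\<dots> \<le> (\<Sum>p\<in>{..<N} \<times> {..<N}. (X (fst p) (snd p))\<^sup>2) * (\<Sum>p\<in>{..<N} \<times> {..<N}. (A $$ p)\<^sup>2)"
    by (rule Cauchy_Schwarz_sum)
  also have "\<dots> = (real N - 2) / (real N - 1) * (\<Sum>i<N. \<Sum>j<N. (A $$ (i, j))\<^sup>2)"
    unfolding XX[symmetric] by (simp add: sum.cartesian_product case_prod_beta)
  finally show ?thesis .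
qed

subsection \<open>Eigenvalue bounds\<close>

lemma scalar_prod_ones:
  "v \<bullet> vec n (\<lambda>_. 1) = (\<Sum>i<n. v $ i)" for v :: "real vec"
  by (simp add: scalar_prod_sum[where n = n])

text \<open>An eigenbasis is built starting from the normalized all-ones vector \<open>u0\<close>.
  All Rayleigh values are nonnegative, so the value 0 of \<open>u0\<close> can head the sorted list,
  and the remaining entries belong to the vectors \<open>vs\<close> orthogonal to \<open>u0\<close>.
  A vector with zero sum has no \<open>u0\<close> component, so its form is a combination of those
  remaining values only.\<close>

lemma unweighted_laplacian_spectrum:
  assumes G: "simple_graph N Es" and N: "2 \<le> N"
  defines "L \<equiv> laplacian N Es (\<lambda>_. 1)"
  shows graph_eigenvalue_2_le: "v \<in> carrier_vec N \<Longrightarrow> (\<Sum>i<N. v $ i) = 0 \<Longrightarrow>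
      graph_eigenvalue N Es 2 * (v \<bullet> v) \<le> v \<bullet> (L *\<^sub>v v)"
    and graph_eigenvalue_N_ge: "v \<in> carrier_vec N \<Longrightarrow> (\<Sum>i<N. v $ i) = 0 \<Longrightarrow>
      v \<bullet> (L *\<^sub>v v) \<le> graph_eigenvalue N Es N * (v \<bullet> v)"
    and graph_eigenvalue_2_eigenvector: "\<exists>u. u \<in> carrier_vec N \<and> u \<bullet> u = 1 \<and>
      (\<Sum>i<N. u $ i) = 0 \<and> L *\<^sub>v u = graph_eigenvalue N Es 2 \<cdot>\<^sub>v u"
proof -
  define u0 where "u0 = (1 / sqrt (real N)) \<cdot>\<^sub>v vec N (\<lambda>_. 1)"
  let ?q = "\<lambda>u. u \<bullet> (L *\<^sub>v u)"
  have L: "L \<in> carrier_mat N N" and sym: "transpose_mat L = L"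
    by (simp_all add: L_def laplacian_symmetric)
  have u0: "u0 \<in> carrier_vec N" "u0 \<bullet> u0 = 1"
    using N by (simp_all add: u0_def scalar_prod_ones)
  have Lu0: "L *\<^sub>v u0 = 0\<^sub>v N"
  proof (rule eq_vecI)
    fix i assume "i < dim_vec (0\<^sub>v N :: real vec)"
    then have i: "i < N"
      by simp
    then have "(L *\<^sub>v u0) $ i = (\<Sum>j<N. if {i, j} \<in> Es then 1 * (u0 $ i - u0 $ j) else 0)"
      unfolding L_def by (rule laplacian_mult_vec[OF G u0(1)])
    also have "\<dots> = 0"
      using i by (intro sum.neutral) (auto simp: u0_def)
    finally show "(L *\<^sub>v u0) $ i = 0\<^sub>v N $ i"
      using i by simp
  qed (simp add: L_def)
  then have "orthonormal_eigenvecs N L [u0]"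
    using u0 by (auto simp: orthonormal_eigenvecs_def)
  then obtain vs where basis: "orthonormal_eigenvecs N L (u0 # vs)" and len: "Suc (length vs) = N"
    using orthonormal_eigenvecs_extend[OF L sym, of "[u0]"] N by auto
  note expand = sorted_eigenvalues_eigenbasis[OF L basis] parseval[OF L basis]
    quadratic_form_eigenbasis[OF L basis]
  have vs: "u \<in> carrier_vec N" if "u \<in> set vs" for u
    using basis that by (auto simp: orthonormal_eigenvecs_def)
  define xs where "xs = map ?q vs"
  have xs: "length xs = N - 1" "xs \<noteq> []"
    using len N by (auto simp: xs_def)
  have "0 \<le> x" if "x \<in> set xs" for x
    using that vs laplacian_nonneg[OF G] by (auto simp: xs_def L_def)
  then have "sorted_eigenvalues L = 0 # sort xs"
    using expand(1) len Lu0 u0 by (simp add: xs_def insort_is_Cons)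
  \<comment> \<open>Eigenvalues are numbered from 1 and list entries from 0, and one further place
    is taken by the leading 0; hence the indices \<open>0\<close> and \<open>N - 2\<close> in
    \<open>sort xs\<close>.\<close>
  then have l2: "graph_eigenvalue N Es 2 = sort xs ! 0"
    and lN: "graph_eigenvalue N Es N = sort xs ! (N - 2)"
    using N by (simp_all add: graph_eigenvalue_def L_def[symmetric] nth_Cons' numeral_2_eq_2)
  have range: "graph_eigenvalue N Es 2 \<le> x" "x \<le> graph_eigenvalue N Es N" if x: "x \<in> set xs" for x
  proof -
    from x obtain i where "i < N - 1" "x = sort xs ! i"
      using xs by (metis in_set_conv_nth length_sort set_sort)
    then show "graph_eigenvalue N Es 2 \<le> x" "x \<le> graph_eigenvalue N Es N"
      unfolding l2 lN using xs by (auto intro!: sorted_nth_mono)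
  qed
  have "graph_eigenvalue N Es 2 \<in> set xs"
    unfolding l2 using xs by (metis length_greater_0_conv length_sort nth_mem set_sort)
  then obtain u where u: "u \<in> set vs" "graph_eigenvalue N Es 2 = ?q u"
    by (auto simp: xs_def)
  then obtain k where k: "k < length vs" "u = vs ! k"
    by (auto simp: in_set_conv_nth)
  have sum0: "u0 \<bullet> w = (\<Sum>i<N. w $ i) / sqrt (real N)" if "w \<in> carrier_vec N" for w
    using that by (simp add: u0_def comm_scalar_prod[of _ N w] scalar_prod_ones)
  have on: "(u0 # vs) ! i \<bullet> (u0 # vs) ! j = (if i = j then 1 else 0)" if "i < N" "j < N" for i j
    using basis that len unfolding orthonormal_eigenvecs_def by simp
  have "u0 \<bullet> u = 0" "u \<bullet> u = 1"
    using on[of 0 "Suc k"] on[of "Suc k" "Suc k"] k len by simp_all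
  moreover have "L *\<^sub>v u = ?q u \<cdot>\<^sub>v u"
    using basis u(1) by (simp add: orthonormal_eigenvecs_def)
  ultimately show "\<exists>u. u \<in> carrier_vec N \<and> u \<bullet> u = 1 \<and> (\<Sum>i<N. u $ i) = 0 \<and>
      L *\<^sub>v u = graph_eigenvalue N Es 2 \<cdot>\<^sub>v u"
    using sum0[OF vs[OF u(1)]] vs[OF u(1)] u(2) N by (intro exI[of _ u]) auto
  assume v: "v \<in> carrier_vec N" "(\<Sum>i<N. v $ i) = 0"
  let ?c = "\<lambda>k. ((u0 # vs) ! k \<bullet> v)\<^sup>2"
  have d: "k = 0 \<and> ?c k = 0 \<or> ?q ((u0 # vs) ! k) \<in> set xs" if "k < N" for k
    using that len v sum0[OF v(1)] by (cases k) (auto simp: xs_def)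
  have "graph_eigenvalue N Es 2 * ?c k \<le> ?q ((u0 # vs) ! k) * ?c k" if "k < N" for k
    using d[OF that] by (elim disjE conjE) (simp_all add: range(1) mult_right_mono)
  then show "graph_eigenvalue N Es 2 * (v \<bullet> v) \<le> ?q v"
    using expand(2,3)[OF _ v(1)] len by (auto simp: sum_distrib_left intro!: sum_mono)
  have "?q ((u0 # vs) ! k) * ?c k \<le> graph_eigenvalue N Es N * ?c k" if "k < N" for k
    using d[OF that] by (elim disjE conjE) (simp_all add: range(2) mult_right_mono)
  then show "?q v \<le> graph_eigenvalue N Es N * (v \<bullet> v)"
    using expand(2,3)[OF _ v(1)] len by (auto simp: sum_distrib_left intro!: sum_mono)
qed

section \<open>Regular graphs\<close>

lemma regular_incident_sum:
  assumes G: "simple_graph N Es" and reg: "regular_graph N Es d" and i: "i < N"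
  shows "incident_sum Es (\<lambda>_. 1) i = real d"
proof -
  have "card {k \<in> {..<N}. {i, k} \<in> Es} = d"
    using reg i by (simp add: regular_graph_def)
  then show ?thesis
    unfolding sum_neighbours[OF G, of i "\<lambda>_. 1", symmetric]
    by (simp add: sum.inter_filter[symmetric] del: lessThan_iff)
qed

text \<open>Summing \<open>(a + b)\<^sup>2 = 2 (a\<^sup>2 + b\<^sup>2) - (a - b)\<^sup>2\<close>
  over the edges gives \<open>B B\<^sup>T = 2 d I - L(1)\<close>, since every vertex lies on
  \<open>d\<close> edges.\<close>

lemma regular_signless_form:
  assumes G: "simple_graph N Es" and reg: "regular_graph N Es d" and v: "v \<in> carrier_vec N"
  shows "(\<Sum>e\<in>Es. (\<Sum>i\<in>e. v $ i)\<^sup>2) = 2 * real d * (v \<bullet> v) - v \<bullet> (laplacian N Es (\<lambda>_. 1) *\<^sub>v v)"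
proof -
  have "(\<Sum>e\<in>Es. \<Sum>i\<in>e. (v $ i)\<^sup>2) = (\<Sum>i<N. (v $ i)\<^sup>2 * incident_sum Es (\<lambda>_. 1) i)"
    by (simp add: sum_mult_incident_sum[OF G])
  also have "\<dots> = real d * (v \<bullet> v)"
    using v by (simp add: regular_incident_sum[OF G reg] scalar_prod_sum sum_distrib_left
        power2_eq_square mult.commute)
  finally show ?thesis
    by (simp add: laplacian_quadratic_form[OF G v] sum_subtractf sum_distrib_left[symmetric])
qed

text \<open>With \<open>y = B \<eta>\<close>, the norm \<open>y \<bullet> y\<close> equals the inner
  product of \<open>\<eta>\<close> with \<open>B\<^sup>T y\<close>. Cauchy-Schwarz and the bound for
  \<open>B B\<^sup>T\<close> on vectors with zero sum then give an inequality from which one factor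
  \<open>y \<bullet> y\<close> cancels.\<close>

lemma regular_mu_quotient_le:
  assumes G: "simple_graph N Es" and N: "2 \<le> N" and reg: "regular_graph N Es d"
    and x: "x \<in> mu_quotients Es"
  shows "x \<le> 2 * real d + 2 - graph_eigenvalue N Es 2"
proof -
  let ?l2 = "graph_eigenvalue N Es 2"
  note fin = simple_graph_finite[OF G]
  obtain \<eta> e where e: "e \<in> Es" "\<eta> e \<noteq> 0" and orth: "(\<Sum>e\<in>Es. \<eta> e) = 0"
    and x_eq: "x = edge_inner Es \<eta> (four_plus_line_adj Es \<eta>) / edge_inner Es \<eta> \<eta>"
    using x by (auto simp: mu_quotients_def edge_inner_def)
  define s where "s = (\<Sum>e\<in>Es. (\<eta> e)\<^sup>2)"
  have s: "s > 0"
    unfolding s_def using fin e by (intro sum_pos2[of _ e]) auto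
  define y where "y = vec N (incident_sum Es \<eta>)"
  have y: "y \<in> carrier_vec N" "(\<Sum>i<N. y $ i) = 0"
    using orth by (simp_all add: y_def sum_incident_sum[OF G])
  have signless: "(\<Sum>e\<in>Es. (\<Sum>i\<in>e. v $ i)\<^sup>2) \<le> (2 * real d - ?l2) * (v \<bullet> v)"
    if "v \<in> carrier_vec N" "(\<Sum>i<N. v $ i) = 0" for v
    using graph_eigenvalue_2_le[OF G N that] by (simp add: regular_signless_form[OF G reg that(1)] algebra_simps)
  \<comment> \<open>Needed when \<open>y \<bullet> y = 0\<close>, where no factor can be cancelled;
    it follows from nonnegativity of the signless form at one unit vector.\<close>
  have l2: "0 \<le> 2 * real d - ?l2"
  proof -
    obtain u :: "real vec" where u: "u \<in> carrier_vec N" "u \<bullet> u = 1" "(\<Sum>i<N. u $ i) = 0"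
      using graph_eigenvalue_2_eigenvector[OF G N] by auto
    have "0 \<le> (\<Sum>e\<in>Es. (\<Sum>i\<in>e. u $ i)\<^sup>2)"
      by (simp add: sum_nonneg)
    then show ?thesis
      using signless[OF u(1,3)] u(2) by simp
  qed
  have yy: "y \<bullet> y = (\<Sum>i<N. (incident_sum Es \<eta> i)\<^sup>2)"
    by (simp add: scalar_prod_sum[OF y(1)]) (simp add: y_def power2_eq_square)
  have "(\<Sum>i\<in>e. incident_sum Es \<eta> i) = (\<Sum>i\<in>e. y $ i)" if "e \<in> Es" for e
  proof (intro sum.cong refl)
    fix i assume "i \<in> e"
    then have "i < N"
      using G that by (auto simp: simple_graph_def)
    then show "incident_sum Es \<eta> i = y $ i"
      by (simp add: y_def)
  qed
  then have "y \<bullet> y = (\<Sum>e\<in>Es. \<eta> e * (\<Sum>i\<in>e. y $ i))"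
    using sum_mult_incident_sum[OF G, of "incident_sum Es \<eta>" \<eta>] by (simp add: yy power2_eq_square)
  then have "(y \<bullet> y)\<^sup>2 \<le> s * (\<Sum>e\<in>Es. (\<Sum>i\<in>e. y $ i)\<^sup>2)"
    unfolding s_def by (simp add: Cauchy_Schwarz_sum)
  also have "\<dots> \<le> s * ((2 * real d - ?l2) * (y \<bullet> y))"
    using signless[OF y] s by (intro mult_left_mono) auto
  finally have "(y \<bullet> y) * (y \<bullet> y) \<le> (s * (2 * real d - ?l2)) * (y \<bullet> y)"
    by (simp add: power2_eq_square)
  then have "y \<bullet> y \<le> s * (2 * real d - ?l2)"
    using scalar_prod_self_nonneg[of y] s l2 by (cases "y \<bullet> y = 0") auto
  then have "edge_inner Es \<eta> (four_plus_line_adj Es \<eta>) \<le> (2 * real d + 2 - ?l2) * s"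
    by (simp add: four_plus_line_adj_form[OF G] yy s_def algebra_simps)
  moreover have "edge_inner Es \<eta> \<eta> = s"
    by (simp add: edge_inner_def s_def power2_eq_square)
  ultimately show ?thesis
    using s by (simp add: x_eq pos_divide_le_eq)
qed

text \<open>A weight with zero sum and a nonzero value needs at least two edges, so the existence of
  a quotient already puts \<open>mu_is_maximum\<close> within reach.\<close>

lemma mu_quotient_le_mu:
  assumes fin: "finite Es" and x: "x \<in> mu_quotients Es"
  shows "x \<le> mu Es"
proof -
  obtain \<eta> :: "nat set \<Rightarrow> real" and e
    where e: "e \<in> Es" "\<eta> e \<noteq> 0" and orth: "(\<Sum>e\<in>Es. \<eta> e) = 0"
    using x by (auto simp: mu_quotients_def edge_inner_def)
  have "Es \<noteq> {e}"
    using e orth by auto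
  then have "2 \<le> card Es"
    using fin e by (metis One_nat_def Suc_1 Suc_leI card_1_singletonE card_gt_0_iff empty_iff
        le_neq_implies_less singletonD)
  then show ?thesis
    using mu_is_maximum(2)[OF fin] x by blast
qed

section \<open>Splitting off the mean weight\<close>

lemma laplacian_shift_form:
  assumes G: "simple_graph N Es" and v: "v \<in> carrier_vec N"
  shows "v \<bullet> (laplacian N Es \<gamma> *\<^sub>v v) =
    c * (v \<bullet> (laplacian N Es (\<lambda>_. 1) *\<^sub>v v)) + v \<bullet> (laplacian N Es (\<lambda>e. \<gamma> e - c) *\<^sub>v v)"
  unfolding laplacian_quadratic_form[OF G v] sum_distrib_left[of c] sum.distrib[symmetric]
  by (intro sum.cong refl) (simp add: algebra_simps)

lemma centered_weights:
  assumes "finite Es"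
  shows "(\<Sum>e\<in>Es. \<gamma> e - weight_mean Es \<gamma>) = 0"
    and "(\<Sum>e\<in>Es. (\<gamma> e - weight_mean Es \<gamma>)\<^sup>2) =
      real (card Es) * (weight_mean_sq Es \<gamma> - (weight_mean Es \<gamma>)\<^sup>2)"
proof -
  let ?E = "real (card Es)" and ?Q = "weight_mean Es \<gamma>"
  \<comment> \<open>For an empty edge set both means are 0 by the convention for division by zero,
    and the identities still hold.\<close>
  have Q: "(\<Sum>e\<in>Es. \<gamma> e) = ?E * ?Q" and P: "(\<Sum>e\<in>Es. (\<gamma> e)\<^sup>2) = ?E * weight_mean_sq Es \<gamma>"
    using assms by (cases "Es = {}"; simp add: weight_mean_def weight_mean_sq_def)+
  show "(\<Sum>e\<in>Es. \<gamma> e - ?Q) = 0"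
    by (simp add: sum_subtractf Q)
  have "(\<Sum>e\<in>Es. (\<gamma> e - ?Q)\<^sup>2) = (\<Sum>e\<in>Es. (\<gamma> e)\<^sup>2) - 2 * ?Q * (\<Sum>e\<in>Es. \<gamma> e) + ?E * ?Q\<^sup>2"
    by (simp add: power2_diff sum.distrib sum_subtractf sum_distrib_left[symmetric]
        sum_distrib_right[symmetric])
  then show "(\<Sum>e\<in>Es. (\<gamma> e - ?Q)\<^sup>2) = ?E * (weight_mean_sq Es \<gamma> - ?Q\<^sup>2)"
    unfolding Q P by (simp add: power2_eq_square algebra_simps)
qed

text \<open>The constant \<open>m\<close> may be any upper bound of the quotients, so that both
  \<open>mu Es\<close> and the bound for regular graphs can be inserted.\<close>

lemma centered_laplacian_form_le:
  assumes G: "simple_graph N Es" and N: "2 \<le> N"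
    and m: "\<And>x. x \<in> mu_quotients Es \<Longrightarrow> x \<le> m"
    and v: "v \<in> carrier_vec N" "v \<bullet> v = 1" "(\<Sum>i<N. v $ i) = 0"
  shows "\<bar>v \<bullet> (laplacian N Es (\<lambda>e. \<gamma> e - weight_mean Es \<gamma>) *\<^sub>v v)\<bar> \<le> deviation_bound N Es \<gamma> m"
proof -
  let ?\<eta> = "\<lambda>e. \<gamma> e - weight_mean Es \<gamma>"
  let ?L = "laplacian N Es ?\<eta>"
  note fin = simple_graph_finite[OF G]
  have eta: "edge_inner Es ?\<eta> (\<lambda>_. 1) = 0"
    using centered_weights(1)[OF fin] by (simp add: edge_inner_def)
  have norm: "edge_inner Es ?\<eta> ?\<eta> = real (card Es) * (weight_mean_sq Es \<gamma> - (weight_mean Es \<gamma>)\<^sup>2)"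
    using centered_weights(2)[OF fin, of \<gamma>] by (simp add: edge_inner_def power2_eq_square)
  \<comment> \<open>Clears the denominator of the quotient; if the centered weights vanish on all
    edges, both sides are 0.\<close>
  have "edge_inner Es ?\<eta> (four_plus_line_adj Es ?\<eta>) \<le> edge_inner Es ?\<eta> ?\<eta> * m"
  proof (cases "\<exists>e\<in>Es. ?\<eta> e \<noteq> 0")
    case True
    then obtain e where "e \<in> Es" "?\<eta> e \<noteq> 0"
      by blast
    then have pos: "0 < edge_inner Es ?\<eta> ?\<eta>"
      unfolding edge_inner_def power2_eq_square[symmetric] using fin
      by (intro sum_pos2[of _ e]) auto
    have "edge_inner Es ?\<eta> (four_plus_line_adj Es ?\<eta>) / edge_inner Es ?\<eta> ?\<eta> \<le> m"
      by (intro m, unfold mu_quotients_def) (use True eta in blast)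
    then show ?thesis
      using pos by (simp add: divide_le_eq mult.commute)
  next
    case False
    then show ?thesis
      by (simp add: edge_inner_def)
  qed
  then have frob: "(\<Sum>i<N. \<Sum>j<N. (?L $$ (i, j))\<^sup>2) \<le> edge_inner Es ?\<eta> ?\<eta> * m"
    by (simp only: laplacian_frobenius[OF G] four_plus_line_adj_form[OF G])
  have "(v \<bullet> (?L *\<^sub>v v))\<^sup>2 \<le> (real N - 2) / (real N - 1) * (\<Sum>i<N. \<Sum>j<N. (?L $$ (i, j))\<^sup>2)"
    using N v centered_weights(1)[OF fin, of \<gamma>]
    by (intro quadratic_form_le_frobenius laplacian_carrier)
      (auto simp: laplacian_row_sum[OF G] laplacian_trace[OF G])
  also have "\<dots> \<le> (real N - 2) / (real N - 1) * (edge_inner Es ?\<eta> ?\<eta> * m)"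
    using N by (intro mult_left_mono frob) auto
  finally have "(v \<bullet> (?L *\<^sub>v v))\<^sup>2 \<le>
      edge_inner Es ?\<eta> ?\<eta> * m * ((real N - 2) / (real N - 1))"
    by (simp add: mult_ac)
  then show ?thesis
    unfolding deviation_bound_def norm[symmetric] by (metis real_sqrt_abs real_sqrt_le_mono)
qed

text \<open>At a unit eigenvector \<open>v\<close> the eigenvalue is \<open>Q\<close> times the
  unweighted form plus the centered form. The unweighted form lies between
  \<open>\<lambda>\<^sub>2\<close> and \<open>\<lambda>\<^sub>N\<close>; multiplication by a
  negative \<open>Q\<close> exchanges these two ends, hence the two sign cases.\<close>

lemma laplacian_eigenvalue_bounds:
  assumes G: "simple_graph N Es" and N: "2 \<le> N"
    and m: "\<And>x. x \<in> mu_quotients Es \<Longrightarrow> x \<le> m"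
    and l: "orth_eigenvalue (laplacian N Es \<gamma>) l"
  defines "Q \<equiv> weight_mean Es \<gamma>"
  shows "(0 \<le> Q \<longrightarrow> Q * graph_eigenvalue N Es 2 - deviation_bound N Es \<gamma> m \<le> l \<and>
            l \<le> Q * graph_eigenvalue N Es N + deviation_bound N Es \<gamma> m) \<and>
         (Q \<le> 0 \<longrightarrow> Q * graph_eigenvalue N Es N - deviation_bound N Es \<gamma> m \<le> l \<and>
            l \<le> Q * graph_eigenvalue N Es 2 + deviation_bound N Es \<gamma> m)"
proof -
  let ?L = "laplacian N Es"
  obtain w where w: "w \<in> carrier_vec N" "w \<noteq> 0\<^sub>v N" "?L \<gamma> *\<^sub>v w = l \<cdot>\<^sub>v w" "(\<Sum>i<N. w $ i) = 0"
    using l by (auto simp: orth_eigenvalue_def eigenvector_def scalar_prod_ones)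
  define v where "v = (1 / sqrt (w \<bullet> w)) \<cdot>\<^sub>v w"
  have v: "v \<in> carrier_vec N" "v \<bullet> v = 1" "(\<Sum>i<N. v $ i) = 0"
    using w normalize_vec[OF w(1,2)] by (simp_all add: v_def sum_divide_distrib[symmetric])
  have "?L \<gamma> *\<^sub>v v = l \<cdot>\<^sub>v v"
    using w by (simp add: v_def mult_mat_vec[OF laplacian_carrier] smult_smult_assoc mult.commute)
  then have "l = v \<bullet> (?L \<gamma> *\<^sub>v v)"
    using v by simp
  also have "\<dots> = Q * (v \<bullet> (?L (\<lambda>_. 1) *\<^sub>v v)) + v \<bullet> (?L (\<lambda>e. \<gamma> e - Q) *\<^sub>v v)"
    by (rule laplacian_shift_form[OF G v(1)])
  finally have l_eq: "l = Q * (v \<bullet> (?L (\<lambda>_. 1) *\<^sub>v v)) + v \<bullet> (?L (\<lambda>e. \<gamma> e - Q) *\<^sub>v v)" .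
  have dev: "\<bar>v \<bullet> (?L (\<lambda>e. \<gamma> e - Q) *\<^sub>v v)\<bar> \<le> deviation_bound N Es \<gamma> m"
    unfolding Q_def by (rule centered_laplacian_form_le[OF G N m v])
  have "graph_eigenvalue N Es 2 \<le> v \<bullet> (?L (\<lambda>_. 1) *\<^sub>v v)"
    "v \<bullet> (?L (\<lambda>_. 1) *\<^sub>v v) \<le> graph_eigenvalue N Es N"
    using graph_eigenvalue_2_le[OF G N v(1,3)] graph_eigenvalue_N_ge[OF G N v(1,3)] v(2) by simp_all
  then show ?thesis
    unfolding l_eq using dev
    by (smt (verit, best) mult_left_mono mult_left_mono_neg)
qed

subsection \<open>Complete graphs\<close>

lemma complete_edges_pair: "{i, j} \<in> complete_edges N \<longleftrightarrow> i \<noteq> j \<and> i < N \<and> j < N"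
  by (auto simp: complete_edges_def card_insert_if)

lemma simple_graph_complete: "simple_graph N (complete_edges N)"
  by (simp add: simple_graph_def complete_edges_def)

lemma regular_graph_complete: "regular_graph N (complete_edges N) (N - 1)"
  unfolding regular_graph_def
proof (intro allI impI)
  fix i assume i: "i < N"
  then have "{k. k < N \<and> {i, k} \<in> complete_edges N} = {..<N} - {i}"
    by (auto simp: complete_edges_pair)
  then show "card {k. k < N \<and> {i, k} \<in> complete_edges N} = N - 1"
    using i by simp
qed

text \<open>On vectors with zero sum the Laplacian of the complete graph acts as multiplication by
  \<open>N\<close>.\<close>

lemma graph_eigenvalue_2_complete:
  assumes N: "2 \<le> N"
  shows "graph_eigenvalue N (complete_edges N) 2 = real N"
proof -
  let ?L = "laplacian N (complete_edges N) (\<lambda>_. 1)" and ?l = "graph_eigenvalue N (complete_edges N) 2"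
  obtain u where u: "u \<in> carrier_vec N" "u \<bullet> u = 1" "(\<Sum>i<N. u $ i) = 0" "?L *\<^sub>v u = ?l \<cdot>\<^sub>v u"
    using graph_eigenvalue_2_eigenvector[OF simple_graph_complete N] by auto
  have "?L *\<^sub>v u = real N \<cdot>\<^sub>v u"
  proof (rule eq_vecI)
    fix i assume "i < dim_vec (real N \<cdot>\<^sub>v u)"
    then have i: "i < N"
      using u by simp
    then have "(?L *\<^sub>v u) $ i =
        (\<Sum>j<N. if {i, j} \<in> complete_edges N then 1 * (u $ i - u $ j) else 0)"
      by (rule laplacian_mult_vec[OF simple_graph_complete u(1)])
    also have "\<dots> = (\<Sum>j<N. u $ i - u $ j)"
      using i by (intro sum.cong) (auto simp: complete_edges_pair)
    also have "\<dots> = (real N \<cdot>\<^sub>v u) $ i"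
      using i u by (simp add: sum_subtractf)
    finally show "(?L *\<^sub>v u) $ i = (real N \<cdot>\<^sub>v u) $ i" .
  qed (use u in simp)
  then have "u \<bullet> (?l \<cdot>\<^sub>v u) = u \<bullet> (real N \<cdot>\<^sub>v u)"
    using u(4) by simp
  then show ?thesis
    using u(1,2) by simp
qed

section \<open>Two-valued weights on the complete graph\<close>

lemma sum_neighbours_complete:
  fixes a b :: real
  assumes i: "i < N"
  shows "(\<Sum>j<N. if {i, j} \<in> complete_edges N then (if 0 \<in> {i, j} then a else b) else 0) =
    (if i = 0 then (real N - 1) * a else a + (real N - 2) * b)"
proof (cases "i = 0")
  case True
  have "(\<Sum>j<N. if {i, j} \<in> complete_edges N then (if 0 \<in> {i, j} then a else b) else 0) =
      (\<Sum>j<N. a + (if j = 0 then - a else 0))"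
    using i True by (intro sum.cong) (auto simp: complete_edges_pair)
  then show ?thesis
    using i True by (simp add: sum.distrib algebra_simps)
next
  case False
  have "(\<Sum>j<N. if {i, j} \<in> complete_edges N then (if 0 \<in> {i, j} then a else b) else 0) =
      (\<Sum>j<N. b + (if j = 0 then a - b else 0) + (if j = i then - b else 0))"
    using i False by (intro sum.cong) (auto simp: complete_edges_pair)
  then show ?thesis
    using i False by (simp add: sum.distrib algebra_simps)
qed

text \<open>There are \<open>N - 1\<close> edges at vertex 0 and \<open>(N - 1) (N - 2) / 2\<close>
  others. The doubled form results from summing over ordered pairs.\<close>

lemma sum_complete_edges:
  fixes a b :: real
  assumes N: "0 < N"
  shows "2 * (\<Sum>e\<in>complete_edges N. if 0 \<in> e then a else b) =
    (real N - 1) * (2 * a + (real N - 2) * b)"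
proof -
  have "2 * (\<Sum>e\<in>complete_edges N. if 0 \<in> e then a else b) =
      (\<Sum>i<N. if i = 0 then (real N - 1) * a else a + (real N - 2) * b)"
    unfolding sum_adjacent_pairs[OF simple_graph_complete, symmetric]
    by (intro sum.cong refl) (simp only: sum_neighbours_complete lessThan_iff)
  also have "\<dots> = (\<Sum>i<N. (a + (real N - 2) * b) +
      (if i = 0 then (real N - 1) * a - (a + (real N - 2) * b) else 0))"
    by (intro sum.cong) auto
  also have "\<dots> = (real N - 1) * (2 * a + (real N - 2) * b)"
    using N by (simp only: sum.distrib) (simp add: algebra_simps)
  finally show ?thesis .
qed

text \<open>
  These weights make \<open>L(\<delta>)\<close> a multiple of \<open>v v\<^sup>T - (I - J / N) / (N - 1)\<close> for
  \<open>v\<close> proportional to \<open>(N - 1, -1, \<dots>, -1)\<close>, which is the equality case in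
  \<open>quadratic_form_le_frobenius\<close>, while \<open>\<delta>\<close> also maximizes the quotient defining \<open>\<mu>\<close>.
\<close>

definition star_weights :: "nat \<Rightarrow> real \<Rightarrow> nat set \<Rightarrow> real" where
  "star_weights N s e = (if 0 \<in> e then s * (real N - 2) else - 2 * s)"

text \<open>For \<open>v = (N - 1, -1, ..., -1)\<close> the difference of endpoint values is nonzero
  only on edges at vertex 0, where it is \<open>N\<close> or \<open>-N\<close>.\<close>

lemma star_weights_eigenvalue:
  assumes N: "2 \<le> N"
  shows "orth_eigenvalue (laplacian N (complete_edges N) (star_weights N s))
    (s * (real N * (real N - 2)))"
proof -
  let ?K = "complete_edges N" and ?l = "s * (real N * (real N - 2))"
  let ?L = "laplacian N ?K (star_weights N s)"
  define v where "v = vec N (\<lambda>i. if i = 0 then real N - 1 else - 1)"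
  have v: "v \<in> carrier_vec N"
    by (simp add: v_def)
  have "?L *\<^sub>v v = ?l \<cdot>\<^sub>v v"
  proof (rule eq_vecI)
    fix i assume "i < dim_vec (?l \<cdot>\<^sub>v v)"
    then have i: "i < N"
      by (simp add: v_def)
    \<comment> \<open>The common contribution of the edges at vertex 0 to row \<open>i\<close>: the
      weight \<open>s (N - 2)\<close> times the difference \<open>N\<close> or
      \<open>-N\<close>.\<close>
    define a where "a = (if i = 0 then ?l else - ?l)"
    have "(?L *\<^sub>v v) $ i =
        (\<Sum>j<N. if {i, j} \<in> ?K then star_weights N s {i, j} * (v $ i - v $ j) else 0)"
      by (rule laplacian_mult_vec[OF simple_graph_complete v i])
    also have "\<dots> = (\<Sum>j<N. if {i, j} \<in> ?K then (if 0 \<in> {i, j} then a else 0) else 0)"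
      using i by (intro sum.cong refl) (auto simp: complete_edges_pair star_weights_def v_def a_def)
    also have "\<dots> = (?l \<cdot>\<^sub>v v) $ i"
      unfolding sum_neighbours_complete[OF i] using i by (simp add: a_def v_def)
    finally show "(?L *\<^sub>v v) $ i = (?l \<cdot>\<^sub>v v) $ i" .
  qed (simp add: v_def)
  moreover have "v \<noteq> 0\<^sub>v N"
  proof
    assume "v = 0\<^sub>v N"
    then have "v $ 0 = 0"
      using N by simp
    then show False
      using N by (simp add: v_def)
  qed
  moreover have "(\<Sum>i<N. v $ i) = 0"
  proof -
    have "(\<Sum>i<N. v $ i) = (\<Sum>i<N. - 1 + (if i = 0 then real N else 0))"
      by (intro sum.cong) (auto simp: v_def)
    then show ?thesis
      using N by (simp add: sum.distrib sum_subtractf)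
  qed
  ultimately show ?thesis
    using v unfolding orth_eigenvalue_def eigenvector_def
    by (intro exI[of _ v]) (simp add: scalar_prod_ones)
qed

text \<open>Here \<open>s\<close> is a sign. The mean vanishes, so both eigenvalue bounds reduce to
  the deviation term, with \<open>m\<close> left open because the value of \<open>mu\<close> is
  derived from this formula.\<close>

lemma star_weights_moments:
  assumes N: "3 \<le> N" and s: "s * s = 1"
  defines "K \<equiv> complete_edges N"
  shows "weight_mean K (star_weights N s) = 0"
    and "(weight_mean K (star_weights N s))\<^sup>2 < weight_mean_sq K (star_weights N s)"
    and "deviation_bound N K (star_weights N s) m = (real N - 2) * sqrt (real N * m)"
proof -
  let ?\<delta> = "star_weights N s"
  have "2 * (\<Sum>e\<in>K. ?\<delta> e) = 0"
    unfolding K_def star_weights_def using N by (subst sum_complete_edges) (auto simp: algebra_simps)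
  then show mean: "weight_mean K ?\<delta> = 0"
    by (simp add: weight_mean_def)
  have "(?\<delta> e)\<^sup>2 = (if 0 \<in> e then (real N - 2)\<^sup>2 else 4)" for e
    using s by (simp add: star_weights_def power_mult_distrib power2_eq_square[of s])
  then have "2 * (\<Sum>e\<in>K. (?\<delta> e)\<^sup>2) = (real N - 1) * (2 * (real N - 2)\<^sup>2 + (real N - 2) * 4)"
    unfolding K_def using N by (simp only: sum_complete_edges)
  also have "\<dots> = 2 * (real N * (real N - 1) * (real N - 2))"
    by (simp add: power2_eq_square algebra_simps)
  finally have sq: "real (card K) * weight_mean_sq K ?\<delta> = real N * (real N - 1) * (real N - 2)"
    using centered_weights(2)[of K ?\<delta>] simple_graph_finite[OF simple_graph_complete]
    by (simp add: mean[unfolded K_def] K_def)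
  have "0 < real N * (real N - 1) * (real N - 2)"
    using N by simp
  then show "(weight_mean K ?\<delta>)\<^sup>2 < weight_mean_sq K ?\<delta>"
    unfolding sq[symmetric] mean by (simp add: zero_less_mult_iff)
  have "real N * (real N - 1) * (real N - 2) * m * ((real N - 2) / (real N - 1)) =
      (real N - 2)\<^sup>2 * (real N * m)"
    using N by (simp add: power2_eq_square field_simps)
  then show "deviation_bound N K ?\<delta> m = (real N - 2) * sqrt (real N * m)"
    using N by (simp add: deviation_bound_def mean sq real_sqrt_mult)
qed

text \<open>The bound for regular graphs with \<open>d = N - 1\<close> and
  \<open>\<lambda>\<^sub>2 = N\<close> gives \<open>2 (N - 1) + 2 - N = N\<close> from above. From
  below, the eigenvalue bound is applied to the star weights: their known eigenvalue would exceed it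
  if \<open>mu\<close> were smaller than \<open>N\<close>.\<close>

lemma mu_complete:
  assumes N: "3 \<le> N"
  shows "mu (complete_edges N) = real N"
proof (rule antisym)
  let ?K = "complete_edges N"
  have N2: "2 \<le> N"
    using N by simp
  note fin = simple_graph_finite[OF simple_graph_complete, of N]
  have upper: "x \<le> real N" if "x \<in> mu_quotients ?K" for x
    using regular_mu_quotient_le[OF simple_graph_complete N2 regular_graph_complete that] N
    by (simp add: graph_eigenvalue_2_complete[OF N2] of_nat_diff)
  \<comment> \<open>Two edges guarantee that \<open>mu\<close> is itself one of the quotients, so
    \<open>upper\<close> applies to it.\<close>
  have "{{0, 1}, {0, 2}} \<subseteq> ?K"
    using N by (simp add: complete_edges_pair)
  then have "card {{0, 1}, {0, 2 :: nat}} \<le> card ?K"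
    by (rule card_mono[OF fin])
  then have "2 \<le> card ?K"
    by (simp add: card_insert_if doubleton_eq_iff)
  then show "mu ?K \<le> real N"
    using upper mu_is_maximum(1)[OF fin] by blast
  have "1 * (real N * (real N - 2)) \<le> (real N - 2) * sqrt (real N * mu ?K)"
    using laplacian_eigenvalue_bounds[OF simple_graph_complete N2 mu_quotient_le_mu[OF fin]
        star_weights_eigenvalue[OF N2, of 1]] N
    by (simp add: star_weights_moments[OF N])
  then have "(real N - 2) * real N \<le> (real N - 2) * sqrt (real N * mu ?K)"
    by (simp add: mult.commute)
  then have "real N \<le> sqrt (real N * mu ?K)"
    by (rule mult_left_le_imp_le) (use N in simp)
  \<comment> \<open>\<open>sqrt\<close> is negative on negative arguments, so a nonnegative root
    forces a nonnegative argument; only then may both sides be squared.\<close>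
  moreover from this have "0 \<le> real N * mu ?K"
    using N by (smt (verit) of_nat_0_le_iff real_sqrt_lt_0_iff of_nat_le_iff of_nat_0 of_nat_numeral)
  ultimately have "(real N)\<^sup>2 \<le> real N * mu ?K"
    by (metis of_nat_0_le_iff power_mono real_sqrt_pow2)
  then show "real N \<le> mu ?K"
    using N by (simp add: power2_eq_square)
qed

text \<open>The inequalities are split by the sign of the mean weight, which decides whether
  \<open>\<lambda>\<^sub>2\<close> or \<open>\<lambda>\<^sub>N\<close> belongs to the lower bound.
  In the tightness claim, the strict inequality between the squared mean and the mean square
  excludes constant weights, for which the deviation term vanishes.\<close>

theorem theorem1p2:
  fixes N :: nat and Es :: "nat set set" and \<gamma> :: "nat set \<Rightarrow> real"
  assumes N: "3 \<le> N"
    and graph: "simple_graph N Es"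
    and conn: "connected_graph N Es"
  shows
    "(\<forall>l. orth_eigenvalue (laplacian N Es \<gamma>) l \<longrightarrow>
        (0 \<le> weight_mean Es \<gamma> \<longrightarrow>
          weight_mean Es \<gamma> * graph_eigenvalue N Es 2 - deviation_bound N Es \<gamma> (mu Es) \<le> l \<and>
          l \<le> weight_mean Es \<gamma> * graph_eigenvalue N Es N + deviation_bound N Es \<gamma> (mu Es)) \<and>
        (weight_mean Es \<gamma> \<le> 0 \<longrightarrow>
          weight_mean Es \<gamma> * graph_eigenvalue N Es N - deviation_bound N Es \<gamma> (mu Es) \<le> l \<and>
          l \<le> weight_mean Es \<gamma> * graph_eigenvalue N Es 2 + deviation_bound N Es \<gamma> (mu Es)))
     \<and>
     (let K = complete_edges N in
        (\<exists>\<delta>. (weight_mean K \<delta>)\<^sup>2 < weight_mean_sq K \<delta> \<and>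
           orth_eigenvalue (laplacian N K \<delta>)
             (weight_mean K \<delta> * graph_eigenvalue N K N + deviation_bound N K \<delta> (mu K))) \<and>
        (\<exists>\<delta>. (weight_mean K \<delta>)\<^sup>2 < weight_mean_sq K \<delta> \<and>
           orth_eigenvalue (laplacian N K \<delta>)
             (weight_mean K \<delta> * graph_eigenvalue N K 2 - deviation_bound N K \<delta> (mu K))))
     \<and>
     (\<forall>d. regular_graph N Es d \<longrightarrow>
        (\<forall>l. orth_eigenvalue (laplacian N Es \<gamma>) l \<longrightarrow>
          (0 \<le> weight_mean Es \<gamma> \<longrightarrow>
            weight_mean Es \<gamma> * graph_eigenvalue N Es 2
              - deviation_bound N Es \<gamma> (2 * real d + 2 - graph_eigenvalue N Es 2) \<le> l \<and>
            l \<le> weight_mean Es \<gamma> * graph_eigenvalue N Es N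
              + deviation_bound N Es \<gamma> (2 * real d + 2 - graph_eigenvalue N Es 2)) \<and>
          (weight_mean Es \<gamma> \<le> 0 \<longrightarrow>
            weight_mean Es \<gamma> * graph_eigenvalue N Es N
              - deviation_bound N Es \<gamma> (2 * real d + 2 - graph_eigenvalue N Es 2) \<le> l \<and>
            l \<le> weight_mean Es \<gamma> * graph_eigenvalue N Es 2
              + deviation_bound N Es \<gamma> (2 * real d + 2 - graph_eigenvalue N Es 2))))"
proof (intro conjI)
  have N2: "2 \<le> N"
    using N by simp
  note fin = simple_graph_finite[OF graph]
  show "\<forall>l. orth_eigenvalue (laplacian N Es \<gamma>) l \<longrightarrow>
        (0 \<le> weight_mean Es \<gamma> \<longrightarrow>
          weight_mean Es \<gamma> * graph_eigenvalue N Es 2 - deviation_bound N Es \<gamma> (mu Es) \<le> l \<and>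
          l \<le> weight_mean Es \<gamma> * graph_eigenvalue N Es N + deviation_bound N Es \<gamma> (mu Es)) \<and>
        (weight_mean Es \<gamma> \<le> 0 \<longrightarrow>
          weight_mean Es \<gamma> * graph_eigenvalue N Es N - deviation_bound N Es \<gamma> (mu Es) \<le> l \<and>
          l \<le> weight_mean Es \<gamma> * graph_eigenvalue N Es 2 + deviation_bound N Es \<gamma> (mu Es))"
    using laplacian_eigenvalue_bounds[OF graph N2 mu_quotient_le_mu[OF fin]] by blast
  \<comment> \<open>With \<open>mu = N\<close> the root \<open>sqrt (N * N)\<close> is
    \<open>N\<close>, so the deviation is exactly the size of the star eigenvalue. The signs
    \<open>s = 1\<close> and \<open>s = - 1\<close> then attain the upper and the lower
    bound.\<close>
  have dev: "deviation_bound N (complete_edges N) (star_weights N s) (mu (complete_edges N)) =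
      real N * (real N - 2)" if "s * s = 1" for s
    using N by (simp add: star_weights_moments(3)[OF N that] mu_complete[OF N])
  show "let K = complete_edges N in
        (\<exists>\<delta>. (weight_mean K \<delta>)\<^sup>2 < weight_mean_sq K \<delta> \<and>
           orth_eigenvalue (laplacian N K \<delta>)
             (weight_mean K \<delta> * graph_eigenvalue N K N + deviation_bound N K \<delta> (mu K))) \<and>
        (\<exists>\<delta>. (weight_mean K \<delta>)\<^sup>2 < weight_mean_sq K \<delta> \<and>
           orth_eigenvalue (laplacian N K \<delta>)
             (weight_mean K \<delta> * graph_eigenvalue N K 2 - deviation_bound N K \<delta> (mu K)))"
    unfolding Let_def
  proof (intro conjI exI)
    show "orth_eigenvalue (laplacian N (complete_edges N) (star_weights N 1))
        (weight_mean (complete_edges N) (star_weights N 1) * graph_eigenvalue N (complete_edges N) N +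
          deviation_bound N (complete_edges N) (star_weights N 1) (mu (complete_edges N)))"
      using star_weights_eigenvalue[OF N2, of 1] by (simp add: dev star_weights_moments(1)[OF N])
    show "orth_eigenvalue (laplacian N (complete_edges N) (star_weights N (- 1)))
        (weight_mean (complete_edges N) (star_weights N (- 1)) * graph_eigenvalue N (complete_edges N) 2 -
          deviation_bound N (complete_edges N) (star_weights N (- 1)) (mu (complete_edges N)))"
      using star_weights_eigenvalue[OF N2, of "- 1"] by (simp add: dev star_weights_moments(1)[OF N])
  qed (simp_all add: star_weights_moments(2)[OF N])
  show "\<forall>d. regular_graph N Es d \<longrightarrow>
        (\<forall>l. orth_eigenvalue (laplacian N Es \<gamma>) l \<longrightarrow>
          (0 \<le> weight_mean Es \<gamma> \<longrightarrow>
            weight_mean Es \<gamma> * graph_eigenvalue N Es 2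
              - deviation_bound N Es \<gamma> (2 * real d + 2 - graph_eigenvalue N Es 2) \<le> l \<and>
            l \<le> weight_mean Es \<gamma> * graph_eigenvalue N Es N
              + deviation_bound N Es \<gamma> (2 * real d + 2 - graph_eigenvalue N Es 2)) \<and>
          (weight_mean Es \<gamma> \<le> 0 \<longrightarrow>
            weight_mean Es \<gamma> * graph_eigenvalue N Es N
              - deviation_bound N Es \<gamma> (2 * real d + 2 - graph_eigenvalue N Es 2) \<le> l \<and>
            l \<le> weight_mean Es \<gamma> * graph_eigenvalue N Es 2
              + deviation_bound N Es \<gamma> (2 * real d + 2 - graph_eigenvalue N Es 2)))"
    using laplacian_eigenvalue_bounds[OF graph N2 regular_mu_quotient_le[OF graph N2]] by blast
qed

end
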